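(* Let $\mathfrak g$ be a real semisimple Lie algebra and let $x$ be a nonzero nilpotent element of $\mathfrak g$, with adjoint orbit $\mathcal O_x$. If $x$ and $-x$ are in the same adjoint orbit, then for all $\beta\in\mathfrak g$, $$\int_{\mathcal O_x} e^{-\langle \beta, y\rangle}\,|\lambda_{\mathcal O_x}|(y) = \infty .$$
   Context: All Lie algebras are finite-dimensional. $\kappa$ denotes the Killing form of $\mathfrak g$, and $\mathfrak g$ is identified with $\mathfrak g^*$ through $\kappa$, so that $\langle\beta,y\rangle=\kappa(\beta,y)$ for $\beta,y\in\mathfrak g$. Adjoint orbits are the orbits in $\mathfrak g$ of the connected adjoint group of $\mathfrak g$. For $X\in\mathfrak g$ let $X^*$ be the vector field $X^*|_y=\operatorname{ad}_X y=[X,y]$. An adjoint orbit $\mathcal O$ carries the Kirillov–Kostant–Souriau symplectic form $\omega_{\mathcal O}|_y(X^*,Y^* )=\kappa(y,[X,Y])$, and its Liouville volume form is $\lambda_{\mathcal O}=\omega_{\mathcal O}^{\dim\mathcal O/2}$; $|\lambda_{\mathcal O}|$ is the associated (positive) measure. *)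

theory Defs
  imports "HOL-Analysis.Analysis"
begin

text \<open>
  A finite-dimensional real Lie algebra is a bilinear bracket \<open>br\<close> on a type of class
  \<open>euclidean_space\<close>. The inner product of that class has no relation to the bracket: it provides
  the topology, a basis in which traces are computed, and a normalisation of Lebesgue measure.
  The Killing form, the orbits and the Liouville measure do not depend on it.
\<close>

definition lie_algebra :: "('a::euclidean_space \<Rightarrow> 'a \<Rightarrow> 'a) \<Rightarrow> bool" where
  "lie_algebra br \<longleftrightarrow>
     bilinear br \<and>
     (\<forall>x. br x x = 0) \<and>
     (\<forall>x y z. br x (br y z) + br y (br z x) + br z (br x y) = 0)"

definition lie_ideal :: "('a::euclidean_space \<Rightarrow> 'a \<Rightarrow> 'a) \<Rightarrow> 'a set \<Rightarrow> bool" where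
  "lie_ideal br I \<longleftrightarrow> subspace I \<and> (\<forall>x. \<forall>y\<in>I. br x y \<in> I)"

primrec derived_series :: "('a::euclidean_space \<Rightarrow> 'a \<Rightarrow> 'a) \<Rightarrow> 'a set \<Rightarrow> nat \<Rightarrow> 'a set" where
  "derived_series br I 0 = I"
| "derived_series br I (Suc k) =
     span {br a b | a b. a \<in> derived_series br I k \<and> b \<in> derived_series br I k}"

definition semisimple_lie_algebra :: "('a::euclidean_space \<Rightarrow> 'a \<Rightarrow> 'a) \<Rightarrow> bool" where
  "semisimple_lie_algebra br \<longleftrightarrow>
     lie_algebra br \<and>
     (\<forall>I. lie_ideal br I \<and> (\<exists>k. derived_series br I k = {0}) \<longrightarrow> I = {0})"

definition trace_op :: "('a::euclidean_space \<Rightarrow> 'a) \<Rightarrow> real" where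
  "trace_op f = (\<Sum>b\<in>Basis. f b \<bullet> b)"

definition killing :: "('a::euclidean_space \<Rightarrow> 'a \<Rightarrow> 'a) \<Rightarrow> 'a \<Rightarrow> 'a \<Rightarrow> real" where
  "killing br x y = trace_op (br x \<circ> br y)"

definition lie_nilpotent :: "('a::euclidean_space \<Rightarrow> 'a \<Rightarrow> 'a) \<Rightarrow> 'a \<Rightarrow> bool" where
  "lie_nilpotent br x \<longleftrightarrow> (\<exists>k. \<forall>y. (br x ^^ k) y = 0)"

definition exp_ad :: "('a::euclidean_space \<Rightarrow> 'a \<Rightarrow> 'a) \<Rightarrow> 'a \<Rightarrow> 'a \<Rightarrow> 'a" where
  "exp_ad br X y = (\<Sum>n. (br X ^^ n) y /\<^sub>R fact n)"

text \<open>
  The connected adjoint group is the group generated by the operators \<open>exp (ad X)\<close>. The inverse of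
  \<open>exp (ad X)\<close> is \<open>exp (ad (- X))\<close>, so products of generators already form a group.
\<close>

inductive_set adjoint_group :: "('a::euclidean_space \<Rightarrow> 'a \<Rightarrow> 'a) \<Rightarrow> ('a \<Rightarrow> 'a) set"
  for br where
  "id \<in> adjoint_group br"
| "g \<in> adjoint_group br \<Longrightarrow> exp_ad br X \<circ> g \<in> adjoint_group br"

definition adjoint_orbit :: "('a::euclidean_space \<Rightarrow> 'a \<Rightarrow> 'a) \<Rightarrow> 'a \<Rightarrow> 'a set" where
  "adjoint_orbit br x = (\<lambda>g. g x) ` adjoint_group br"

text \<open>The tangent space at \<open>y\<close> of the orbit of \<open>y\<close>, i.e. the values at \<open>y\<close> of the fields \<open>X\<^sup>*\<close>.\<close>

definition orbit_tangent :: "('a::euclidean_space \<Rightarrow> 'a \<Rightarrow> 'a) \<Rightarrow> 'a \<Rightarrow> 'a set" where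
  "orbit_tangent br y = range (\<lambda>X. br X y)"

text \<open>
  The Kirillov--Kostant--Souriau form at \<open>y\<close>. For tangent vectors \<open>v\<close>, \<open>w\<close> the value does not depend
  on the choice of \<open>X\<close>, \<open>Y\<close> (see \<open>kks_form_eq\<close> below).
\<close>

definition kks_form ::
    "('a::euclidean_space \<Rightarrow> 'a \<Rightarrow> 'a) \<Rightarrow> 'a \<Rightarrow> 'a \<Rightarrow> 'a \<Rightarrow> real" where
  "kks_form br y v w =
     (THE c. \<exists>X Y. br X y = v \<and> br Y y = w \<and> c = killing br y (br X Y))"

text \<open>
  The \<open>n\<close>-fold exterior power of a 2-form, evaluated on \<open>v 0, \<dots>, v (2 n - 1)\<close>. This is
  \<open>\<omega> \<and> \<dots> \<and> \<omega>\<close> written out, for the convention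
  \<open>(\<alpha> \<and> \<beta>) (v 0, \<dots>) = 1 / (p! q!) (\<Sum>\<sigma>. sign \<sigma> \<alpha> (v (\<sigma> 0), \<dots>) \<beta> (v (\<sigma> p), \<dots>))\<close>.
\<close>

definition two_form_power :: "('a \<Rightarrow> 'a \<Rightarrow> real) \<Rightarrow> nat \<Rightarrow> (nat \<Rightarrow> 'a) \<Rightarrow> real" where
  "two_form_power \<omega> n v =
     (\<Sum>\<sigma> | \<sigma> permutes {..<2 * n}.
        of_int (sign \<sigma>) * (\<Prod>i<n. \<omega> (v (\<sigma> (2 * i))) (v (\<sigma> (2 * i + 1))))) / 2 ^ n"

definition liouville_form ::
    "('a::euclidean_space \<Rightarrow> 'a \<Rightarrow> 'a) \<Rightarrow> 'a \<Rightarrow> (nat \<Rightarrow> 'a) \<Rightarrow> real" where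
  "liouville_form br y v = two_form_power (kks_form br y) (dim (orbit_tangent br y) div 2) v"

text \<open>
  Local parametrisations of the orbit. The dimension \<open>d\<close> of the orbit depends on \<open>x\<close>, so it cannot be
  the dimension of a type. The role of \<open>\<real>\<^sup>d\<close> is played by the span of a list \<open>bs\<close> of \<open>d\<close> distinct
  vectors of the standard basis, with the coordinates and the Lebesgue measure given by \<open>bs\<close>.
\<close>

definition lborel_span :: "'a::euclidean_space list \<Rightarrow> 'a measure" where
  "lborel_span bs =
     distr (\<Pi>\<^sub>M b\<in>set bs. (lborel :: real measure)) (restrict_space borel (span (set bs)))
       (\<lambda>c. \<Sum>b\<in>set bs. c b *\<^sub>R b)"

text \<open>
  \<open>\<phi>\<close> is an injective \<open>C\<^sup>1\<close> map from the open subset \<open>U\<close> of the parameter space into the orbit, whose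
  derivative \<open>D u\<close> maps the parameter space onto the tangent space of the orbit (hence
  isomorphically, by dimension).
\<close>

definition orbit_param ::
    "('a::euclidean_space \<Rightarrow> 'a \<Rightarrow> 'a) \<Rightarrow> 'a \<Rightarrow> 'a list \<Rightarrow> 'a set \<Rightarrow> ('a \<Rightarrow> 'a) \<Rightarrow> ('a \<Rightarrow> 'a \<Rightarrow> 'a) \<Rightarrow> bool"
  where
  "orbit_param br x bs U \<phi> D \<longleftrightarrow>
     distinct bs \<and> set bs \<subseteq> Basis \<and> length bs = dim (orbit_tangent br x) \<and>
     openin (top_of_set (span (set bs))) U \<and>
     inj_on \<phi> U \<and> \<phi> ` U \<subseteq> adjoint_orbit br x \<and>
     (\<forall>u\<in>U. (\<phi> has_derivative D u) (at u within span (set bs))) \<and>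
     (\<forall>b\<in>set bs. continuous_on U (\<lambda>u. D u b)) \<and>
     (\<forall>u\<in>U. D u ` span (set bs) = orbit_tangent br (\<phi> u))"

text \<open>
  The part of \<open>|\<lambda>|\<close> living on \<open>\<phi> ` U\<close>: the image under \<open>\<phi>\<close> of \<open>|\<phi>\<^sup>*\<lambda>|\<close>, whose density with respect
  to Lebesgue measure is \<open>|\<lambda> (\<partial>\<^sub>1 \<phi>, \<dots>, \<partial>\<^sub>d \<phi>)|\<close>.
\<close>

definition param_measure ::
    "('a::euclidean_space \<Rightarrow> 'a \<Rightarrow> 'a) \<Rightarrow> 'a \<Rightarrow> 'a list \<Rightarrow> 'a set \<Rightarrow> ('a \<Rightarrow> 'a) \<Rightarrow> ('a \<Rightarrow> 'a \<Rightarrow> 'a) \<Rightarrow> 'a measure"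
  where
  "param_measure br x bs U \<phi> D =
     distr
       (density (restrict_space (lborel_span bs) U)
          (\<lambda>u. ennreal \<bar>liouville_form br (\<phi> u) (\<lambda>i. D u (bs ! i))\<bar>))
       (restrict_space borel (adjoint_orbit br x))
       \<phi>"

text \<open>
  By the change of variables formula each \<open>param_measure\<close> is the restriction of \<open>|\<lambda>|\<close> to
  \<open>\<phi> ` U\<close>. As countably many of the sets \<open>\<phi> ` U\<close> cover the orbit, \<open>|\<lambda>|\<close> is the least upper
  bound of these restrictions in the lattice of measures on the orbit. (This \<open>Sup\<close> is not the
  pointwise supremum of the values of the measures; it is the least measure above all of them.)
\<close>

definition liouville_measure :: "('a::euclidean_space \<Rightarrow> 'a \<Rightarrow> 'a) \<Rightarrow> 'a \<Rightarrow> 'a measure" where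
  "liouville_measure br x =
     Sup {param_measure br x bs U \<phi> D | bs U \<phi> D. orbit_param br x bs U \<phi> D}"

lemma trace_op_comm:
  fixes f g :: "'a::euclidean_space \<Rightarrow> 'a"
  assumes f: "linear f" and g: "linear g"
  shows "trace_op (f \<circ> g) = trace_op (g \<circ> f)"
proof -
  have eq: "trace_op (f \<circ> g) = (\<Sum>b\<in>Basis. \<Sum>c\<in>Basis. (g b \<bullet> c) * (f c \<bullet> b))"
    if "linear f" for f g :: "'a \<Rightarrow> 'a"
  proof -
    have "f (g b) \<bullet> b = (\<Sum>c\<in>Basis. (g b \<bullet> c) * (f c \<bullet> b))" for b
    proof -
      have "f (g b) = f (\<Sum>c\<in>Basis. (g b \<bullet> c) *\<^sub>R c)"
        by (simp add: euclidean_representation)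
      also have "\<dots> = (\<Sum>c\<in>Basis. (g b \<bullet> c) *\<^sub>R f c)"
        using that by (simp add: linear_sum linear_cmul)
      finally show ?thesis by (simp add: inner_sum_left)
    qed
    then show ?thesis by (simp add: trace_op_def)
  qed
  show ?thesis
    unfolding eq[OF f] eq[OF g] by (subst sum.swap) (simp add: mult.commute)
qed

lemma killing_invariant:
  assumes L: "lie_algebra br"
  shows "killing br x (br y z) = killing br (br x y) z"
proof -
  have bil: "bilinear br" and alt: "\<And>x. br x x = 0"
    and jac: "\<And>x y z. br x (br y z) + br y (br z x) + br z (br x y) = 0"
    using L by (auto simp: lie_algebra_def)
  have lin: "linear (br x)" for x using bil by (simp add: bilinear_def)
  have anti: "br a b = - br b a" for a b
    using alt[of "a + b"] alt[of a] alt[of b] bilinear_ladd[OF bil] bilinear_radd[OF bil]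
    by (simp add: eq_neg_iff_add_eq_0 add.commute)
  have ad: "br (br a b) = (\<lambda>w. br a (br b w) - br b (br a w))" for a b
  proof
    fix w
    have "br b (br w a) = - br b (br a w)"
      by (metis anti linear_neg[OF lin])
    then have "br a (br b w) - br b (br a w) + br w (br a b) = 0"
      using jac[of a b w] by simp
    then have "- br w (br a b) = br a (br b w) - br b (br a w)"
      by (metis add_eq_0_iff2 minus_minus)
    then show "br (br a b) w = br a (br b w) - br b (br a w)" by (metis anti)
  qed
  have "trace_op ((br x \<circ> br z) \<circ> br y) = trace_op (br y \<circ> (br x \<circ> br z))"
    by (intro trace_op_comm linear_compose lin)
  then have "trace_op (\<lambda>w. br x (br z (br y w))) = trace_op (\<lambda>w. br y (br x (br z w)))"
    by (simp add: comp_def)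
  then show ?thesis
    unfolding killing_def comp_def ad
    by (simp add: trace_op_def linear_diff[OF lin] inner_diff_left sum_subtractf)
qed

lemma kks_form_eq:
  assumes L: "lie_algebra br"
  shows "kks_form br y (br X y) (br Y y) = killing br y (br X Y)"
proof -
  have bil: "bilinear br" and alt: "\<And>x. br x x = 0"
    using L by (auto simp: lie_algebra_def)
  have anti: "br a b = - br b a" for a b
    using alt[of "a + b"] alt[of a] alt[of b] bilinear_ladd[OF bil] bilinear_radd[OF bil]
    by (simp add: eq_neg_iff_add_eq_0 add.commute)
  have neg: "killing br y (- z) = - killing br y z" for y z
    using bil by (simp add: killing_def trace_op_def bilinear_lneg bilinear_rneg sum_negf)
  have "killing br y (br X' Y') = killing br y (br X Y)"
    if X: "br X' y = br X y" and Y: "br Y' y = br Y y" for X' Y'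
  proof -
    have "killing br y (br X' Y') = killing br y (br X Y')"
      unfolding killing_invariant[OF L] using X by (metis anti)
    also have "\<dots> = - killing br y (br Y' X)"
      using neg anti[of X Y'] by simp
    also have "\<dots> = - killing br y (br Y X)"
      unfolding killing_invariant[OF L] using Y by (metis anti)
    also have "\<dots> = killing br y (br X Y)"
      using neg anti[of X Y] by simp
    finally show ?thesis .
  qed
  then show ?thesis
    unfolding kks_form_def by (intro the_equality) blast+
qed

end

(*
  Since x is nilpotent there is h with [h, x] = x, so exp (ad (s h)) x = e^s x and the orbit is
  invariant under positive scalars; as it contains - x, it is invariant under all scalars +- e^s.
  Scaling by s multiplies the Liouville form of an orbit of dimension 2 n by s^n. A chart of the
  orbit contains a set of positive measure on which y |-> <beta, y> has a constant sign; scaling it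
  by +- e^k, with the sign that makes the integrand at least 1, shows that the integral is at least
  of order e^(k n) for every k.

  Both the existence of h and the positivity of the Liouville form rest on the nondegeneracy of the
  Killing form. If P = [P, P] is an ideal in its radical and x is in P, let T be the conjugate of
  the semisimple part of ad x, a derivation of the complexification. Then tr (ad x T), the sum of
  the squared moduli of the eigenvalues of ad x, vanishes, so ad x is nilpotent, and Engel's theorem
  gives P = 0.
*)
theory Submission
  imports
    Defs
    "HOL-Computational_Algebra.Fundamental_Theorem_Algebra"
    "HOL-Computational_Algebra.Field_as_Ring"
    "HOL-Computational_Algebra.Polynomial_Factorial"
    "HOL-Combinatorics.Permutations"
begin

text \<open>The Liouville form is homogeneous of degree n, not 2 n, because a tangent vector enters
  only through an element X producing it: at s y the same X produces s [X, y], and \<kappa>(s y,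
  [X, Y]) is linear in s. The growth is genuine since n > 0, x being a nonzero tangent vector at x.
  The measure is a supremum, so one chart gives a lower bound, and a chart followed by an admissible
  scaling is again a chart of the same orbit; hence every estimate is an integral over one fixed
  parameter domain. The sign is essential: where <\<beta>, y> is positive, the integrand decays
  under positive scaling. The eigenvalues of ad x are complex in general, whence the
  complexification, modelled on pairs so that real traces still apply. Conjugation of eigenvalues
  serves twice: it is additive, which makes T a derivation, and l times its conjugate is
  nonnegative, so nothing can cancel in the trace.\<close>

section \<open>Traces of nilpotent and idempotent operators\<close>

lemma trace_op_add: "trace_op (\<lambda>v. f v + g v) = trace_op f + trace_op g"
  by (simp add: trace_op_def inner_add_left sum.distrib)

lemma trace_op_scaleR: "trace_op (\<lambda>v. c *\<^sub>R f v) = c * trace_op f"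
  by (simp add: trace_op_def sum_distrib_left)

lemma trace_op_sum: "trace_op (\<lambda>v. \<Sum>i\<in>I. f i v) = (\<Sum>i\<in>I. trace_op (f i))"
  by (simp add: trace_op_def inner_sum_left sum.swap[of _ Basis])

text \<open>The last conclusion is self-adjointness combined with idempotence; it later turns the
  trace of \<open>Q\<close> into a sum of squares.\<close>

lemma orthogonal_projection_exists:
  fixes S :: "'a::euclidean_space set"
  assumes "subspace S"
  obtains Q where "linear Q" "\<And>v. Q v \<in> S" "\<And>v. v \<in> S \<Longrightarrow> Q v = v" "\<And>v. Q v \<bullet> v = (norm (Q v))\<^sup>2"
proof -
  obtain B where B: "B \<subseteq> S" "pairwise orthogonal B" "\<And>x. x \<in> B \<Longrightarrow> norm x = 1"
    "independent B" "span B = S"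
    using orthonormal_basis_subspace[OF assms] by metis
  have fin: "finite B" using B(4) by (rule independent_imp_finite)
  define Q where "Q v = (\<Sum>b\<in>B. (v \<bullet> b) *\<^sub>R b)" for v
  have lin: "linear Q"
    unfolding Q_def by (intro linearI) (simp_all add: inner_add_left scaleR_add_left sum.distrib scaleR_right.sum)
  have bb: "b \<bullet> c = (if b = c then 1 else 0)" if "b \<in> B" "c \<in> B" for b c
    using B(2,3) that by (auto simp: pairwise_def orthogonal_def dot_square_norm)
  have id: "Q v = v" if "v \<in> S" for v
  proof -
    have "Q b = b" if "b \<in> B" for b
      using that bb fin by (simp add: Q_def if_distrib[of "\<lambda>t. t *\<^sub>R _"] cong: if_cong)
    moreover have "v \<in> span B" using that B(5) by simp
    ultimately show ?thesis
      using linear_eq_on_span[OF lin linear_ident, of B v] by auto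
  qed
  have mem: "Q v \<in> S" for v
    unfolding Q_def using B(1) assms by (intro subspace_sum subspace_scale) auto
  have sym: "Q v \<bullet> w = v \<bullet> Q w" for v w
    by (simp add: Q_def inner_sum_left inner_sum_right inner_commute mult.commute)
  have "Q v \<bullet> v = (norm (Q v))\<^sup>2" for v
    using sym[of "Q v" v] id[OF mem] by (simp add: dot_square_norm)
  with lin mem id show ?thesis using that by blast
qed

text \<open>Induction on the exponent: with \<open>Q\<close> the projection that kills the kernel of
  \<open>f\<close>, \<open>f \<circ> Q = f\<close>, so \<open>Q \<circ> f\<close> has the trace of
  \<open>f\<close>, while its nilpotency exponent is one less.\<close>

lemma trace_op_nilpotent:
  fixes f :: "'a::euclidean_space \<Rightarrow> 'a"
  assumes "linear f" "\<And>v. (f ^^ k) v = 0"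
  shows "trace_op f = 0"
  using assms
proof (induction k arbitrary: f)
  case 0
  have "f b = 0" for b using "0.prems"(2)[of "f b"] by simp
  then show ?case by (simp add: trace_op_def)
next
  case (Suc k)
  define K where "K = {v. f v = 0}"
  have "subspace K"
    unfolding K_def using Suc.prems(1) by (rule linear_subspace_kernel)
  then obtain Q' where Q': "linear Q'" "\<And>v. Q' v \<in> K" "\<And>v. v \<in> K \<Longrightarrow> Q' v = v"
    by (rule orthogonal_projection_exists) blast
  define Q where "Q v = v - Q' v" for v
  have linQ: "linear Q"
    unfolding Q_def by (intro linear_compose_sub linear_ident Q'(1))
  have fQ: "f (Q v) = f v" for v
    using Q'(2)[of v] linear_diff[OF Suc.prems(1)] by (simp add: Q_def K_def)
  have pow: "((Q \<circ> f) ^^ m) (Q v) = Q ((f ^^ m) v)" for m v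
    by (induction m) (simp_all add: fQ)
  have "trace_op (Q \<circ> f) = 0"
  \<comment> \<open>The identity \<open>(Q \<circ> f) ^^ k = Q \<circ> (f ^^ k)\<close> starts at
    exponent 1, so exponent 0 is treated apart.\<close>
  proof (cases k)
    case 0
    then have "f v = 0" for v using Suc.prems(2) by simp
    then show ?thesis
      using linear_0[OF linQ] by (simp add: trace_op_def)
  next
    case (Suc m)
    show ?thesis
    proof (rule Suc.IH)
      show "linear (Q \<circ> f)" by (intro linear_compose Suc.prems linQ)
      fix v
      have "((Q \<circ> f) ^^ k) v = ((Q \<circ> f) ^^ m) (Q (f v))"
        by (simp add: Suc funpow_swap1)
      also have "\<dots> = Q ((f ^^ k) v)"
        by (simp add: pow Suc funpow_swap1)
      also have "\<dots> = 0"
        using Suc.prems(2)[of v] Q'(3)[of "(f ^^ k) v"] by (simp add: Q_def K_def)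
      finally show "((Q \<circ> f) ^^ k) v = 0" .
    qed
  qed
  moreover have "f \<circ> Q = f" by (simp add: fun_eq_iff fQ)
  ultimately show ?case
    using trace_op_comm[OF linQ Suc.prems(1)] by simp
qed

text \<open>\<open>f\<close> and the orthogonal projection \<open>Q\<close> onto its range satisfy
  \<open>Q \<circ> f = f\<close> and \<open>f \<circ> Q = Q\<close>, so cyclicity gives them the
  same trace, and that of \<open>Q\<close> is a sum of squared norms.\<close>

lemma trace_op_idempotent:
  fixes f :: "'a::euclidean_space \<Rightarrow> 'a"
  assumes f: "linear f" and idem: "\<And>v. f (f v) = f v"
  shows "trace_op f \<ge> 0" "trace_op f = 0 \<Longrightarrow> f v = 0"
proof -
  have "subspace (range f)"
    using f by (simp add: linear_subspace_image)
  then obtain Q where Q: "linear Q" "\<And>v. Q v \<in> range f" "\<And>v. v \<in> range f \<Longrightarrow> Q v = v"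
      "\<And>v. Q v \<bullet> v = (norm (Q v))\<^sup>2"
    by (rule orthogonal_projection_exists) blast
  have Qf: "Q \<circ> f = f" using Q(3) by (auto simp: fun_eq_iff)
  have fQ: "f \<circ> Q = Q"
  proof
    fix v
    obtain w where "Q v = f w" using Q(2)[of v] by auto
    then show "(f \<circ> Q) v = Q v" using idem by simp
  qed
  have "trace_op f = trace_op Q"
    using trace_op_comm[OF f Q(1)] Qf fQ by simp
  also have "\<dots> = (\<Sum>b\<in>Basis. (norm (Q b))\<^sup>2)"
    by (simp add: trace_op_def Q(4))
  finally have tr: "trace_op f = (\<Sum>b\<in>Basis. (norm (Q b))\<^sup>2)" .
  show "trace_op f \<ge> 0" unfolding tr by (intro sum_nonneg) auto
  show "f v = 0" if "trace_op f = 0"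
  proof -
    have "Q b = 0" if "b \<in> Basis" for b
      using \<open>trace_op f = 0\<close> that unfolding tr
      by (subst (asm) sum_nonneg_eq_0_iff) auto
    then have "Q w = 0" for w
      using linear_eq_stdbasis[OF Q(1) linear_zero] by auto
    then show ?thesis using Qf by (metis comp_apply)
  qed
qed

section \<open>Complexification and the primary decomposition of an operator\<close>

text \<open>The pair (a, b) stands for a + i b. The carrier stays a euclidean space, so
  \<open>trace_op\<close> and dimension arguments remain available.\<close>

definition cscale :: "complex \<Rightarrow> 'a::real_vector \<times> 'a \<Rightarrow> 'a \<times> 'a" where
  "cscale c v = (Re c *\<^sub>R fst v - Im c *\<^sub>R snd v, Im c *\<^sub>R fst v + Re c *\<^sub>R snd v)"

interpretation cscale: vector_space cscale
  by unfold_locales (auto simp: cscale_def algebra_simps)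

lemma cscale_of_real: "cscale (of_real r) v = r *\<^sub>R v"
  by (simp add: cscale_def prod_eq_iff)

locale clinear_op =
  fixes A :: "'a::euclidean_space \<times> 'a \<Rightarrow> 'a \<times> 'a"
  assumes add: "A (v + w) = A v + A w" and scale: "A (cscale c v) = cscale c (A v)"
begin

lemma zero [simp]: "A 0 = 0"
  using scale[of 0 0] by simp

text \<open>This is p(A), evaluated by Horner's scheme.\<close>

definition poly_op :: "complex poly \<Rightarrow> 'a \<times> 'a \<Rightarrow> 'a \<times> 'a" where
  "poly_op p = fold_coeffs (\<lambda>a f v. cscale a v + A (f v)) p (\<lambda>v. 0)"

lemma poly_op_0 [simp]: "poly_op 0 v = 0"
  by (simp add: poly_op_def)

lemma poly_op_pCons [simp]: "poly_op (pCons a p) v = cscale a v + A (poly_op p v)"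
  by (cases "p = 0 \<and> a = 0") (auto simp: poly_op_def)

lemma poly_op_1 [simp]: "poly_op 1 v = v"
  by (simp add: one_pCons)

lemma poly_op_add_right: "poly_op p (v + w) = poly_op p v + poly_op p w"
  by (induction p) (simp_all add: add cscale.scale_right_distrib)

lemma poly_op_scale_right: "poly_op p (cscale c v) = cscale c (poly_op p v)"
  by (induction p) (simp_all add: scale cscale.scale_right_distrib mult.commute)

lemma poly_op_linear: "linear (poly_op p)"
  by (rule linearI) (simp_all add: poly_op_add_right flip: cscale_of_real add: poly_op_scale_right)

lemma poly_op_zero_right [simp]: "poly_op p 0 = 0"
  by (rule linear_0[OF poly_op_linear])

lemma poly_op_add: "poly_op (p + q) v = poly_op p v + poly_op q v"
  by (induction p q rule: poly_induct2) (simp_all add: add cscale.scale_left_distrib)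

lemma poly_op_smult: "poly_op (smult c p) v = cscale c (poly_op p v)"
  by (induction p) (simp_all add: scale cscale.scale_right_distrib)

lemma poly_op_mult: "poly_op (p * q) v = poly_op p (poly_op q v)"
  by (induction p) (simp_all add: poly_op_add poly_op_smult)

lemma poly_op_power: "poly_op (p ^ k) v = (poly_op p ^^ k) v"
  by (induction k) (simp_all add: poly_op_mult)

lemma poly_op_sum: "poly_op (\<Sum>i\<in>I. p i) v = (\<Sum>i\<in>I. poly_op (p i) v)"
  by (induction I rule: infinite_finite_induct) (simp_all add: poly_op_add)

lemma poly_op_diff: "poly_op (p - q) v = poly_op p v - poly_op q v"
  using poly_op_add[of "p - q" q v] by simp

lemma poly_op_dvd: "p dvd q \<Longrightarrow> poly_op p v = 0 \<Longrightarrow> poly_op q v = 0"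
  by (elim dvdE) (simp add: poly_op_mult mult.commute[of p])

lemma poly_op_coprime:
  assumes "coprime p q" "poly_op p v = 0" "poly_op q v = 0"
  shows "v = 0"
proof -
  obtain a b where "a * p + b * q = 1"
    using bezout_coefficients_fst_snd[of p q] assms(1) by (metis coprime_imp_gcd_eq_1)
  then have "poly_op (a * p + b * q) v = v" by simp
  then show ?thesis using assms by (simp add: poly_op_add poly_op_mult)
qed

lemma coprime_linear_powers:
  fixes l m :: complex
  assumes "l \<noteq> m"
  shows "coprime ([:- l, 1:] ^ j) ([:- m, 1:] ^ k)"
proof -
  have "smult (inverse (m - l)) [:- l, 1:] - smult (inverse (m - l)) [:- m, 1:] = 1"
    using assms by (simp add: one_pCons flip: right_diff_distrib)
  then have "coprime [:- l, 1:] [:- m, 1:]"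
    by (intro coprimeI) (metis dvd_diff dvd_smult)
  then show ?thesis by simp
qed

text \<open>Linear dependence among the iterates \<open>v, A v, A\<^sup>2 v, \<dots>\<close> gives an annihilating polynomial.\<close>

lemma annihilator_vector_exists: "\<exists>p. p \<noteq> 0 \<and> poly_op p v = 0"
proof -
  define n where "n = DIM('a \<times> 'a)"
  have mon: "poly_op (monom c k) v = cscale c ((A ^^ k) v)" for c k
  proof (induction k)
    case (Suc k)
    then show ?case by (simp add: monom_Suc scale)
  qed (simp add: monom_0)
  show ?thesis
  \<comment> \<open>Linear dependence concerns the set of iterates, so a repetition among them is
    treated apart: there the difference of two monomials annihilates \<open>v\<close>.\<close>
  proof (cases "inj_on (\<lambda>k. (A ^^ k) v) {..n}")
    case False
    then obtain i j where ij: "i \<noteq> j" "(A ^^ i) v = (A ^^ j) v" by (auto simp: inj_on_def)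
    have "monom 1 i - monom 1 j \<noteq> (0 :: complex poly)"
    proof
      assume "monom 1 i - monom 1 j = (0 :: complex poly)"
      then have "coeff (monom 1 i - monom 1 j :: complex poly) i = 0" by simp
      then show False using ij(1) by simp
    qed
    then show ?thesis using ij(2) by (intro exI[of _ "monom 1 i - monom 1 j"]) (simp add: poly_op_diff mon)
  next
    case True
    define S where "S = (\<lambda>k. (A ^^ k) v) ` {..n}"
    have "card S = Suc n" using True by (simp add: S_def card_image)
    then have "dependent S"
      by (intro dependent_biggerset) (simp_all add: S_def n_def)
    moreover have "finite S" by (simp add: S_def)
    ultimately obtain c w where c: "(\<Sum>w\<in>S. c w *\<^sub>R w) = 0" "w \<in> S" "c w \<noteq> 0"
      using dependent_finite by blast
    define p where "p = (\<Sum>k\<le>n. monom (complex_of_real (c ((A ^^ k) v))) k)"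
    obtain k where "k \<le> n" "w = (A ^^ k) v" using c(2) by (auto simp: S_def)
    then have "coeff p k \<noteq> 0" using c(3) by (simp add: p_def coeff_sum)
    moreover have "poly_op p v = (\<Sum>w\<in>S. c w *\<^sub>R w)"
      unfolding S_def using True by (simp add: p_def poly_op_sum mon sum.reindex cscale_of_real)
    ultimately show ?thesis using c(1) by (intro exI[of _ p]) auto
  qed
qed

lemma annihilator_exists: "\<exists>p. p \<noteq> 0 \<and> (\<forall>v. poly_op p v = 0)"
proof -
  obtain q where q: "\<And>b. q b \<noteq> 0" "\<And>b. poly_op (q b) b = 0"
    using annihilator_vector_exists by metis
  define p where "p = (\<Prod>b\<in>Basis. q b)"
  have "poly_op p b = 0" if "b \<in> Basis" for b
    unfolding p_def using that by (intro poly_op_dvd[OF _ q(2)] dvd_prodI finite_Basis)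
  then have "poly_op p v = 0" for v
    using linear_eq_stdbasis[OF poly_op_linear linear_zero] by metis
  moreover have "p \<noteq> 0" using q(1) by (simp add: p_def)
  ultimately show ?thesis by blast
qed

text \<open>An annihilator may be replaced by any multiple, so all roots receive the same exponent.
  Adding 0 to the roots makes \<open>L\<close> nonempty and provides a projection onto the
  generalised kernel of \<open>A\<close>, to which everything is reduced when \<open>A\<close> is
  nilpotent.\<close>

lemma annihilator_split:
  obtains L N where "finite L" "0 \<in> L" "\<And>v. poly_op (\<Prod>l\<in>L. [:- l, 1:] ^ N) v = 0"
proof -
  obtain p where p: "p \<noteq> 0" "\<And>v. poly_op p v = 0" using annihilator_exists by blast
  define R where "R = {z. poly p z = 0}"
  have fin: "finite R" using p(1) by (simp add: R_def poly_roots_finite)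
  have "smult (lead_coeff p) (\<Prod>z\<in>R. [:- z, 1:] ^ order z p) dvd (\<Prod>z\<in>R. [:- z, 1:] ^ order z p)"
    using p(1) by (simp add: smult_dvd_iff)
  then have "p dvd (\<Prod>z\<in>R. [:- z, 1:] ^ order z p)"
    unfolding R_def complex_poly_decompose .
  also have "\<dots> dvd (\<Prod>z\<in>R. [:- z, 1:] ^ degree p)"
    using order_degree[OF p(1)] by (intro prod_dvd_prod le_imp_power_dvd) auto
  also have "\<dots> dvd (\<Prod>z\<in>insert 0 R. [:- z, 1:] ^ degree p)"
    using fin by (intro prod_dvd_prod_subset) auto
  finally show ?thesis
    using that[of "insert 0 R" "degree p"] fin poly_op_dvd p(2) by blast
qed

end

text \<open>Chinese remainder theorem: \<open>e l\<close> is 1 modulo \<open>f l\<close> and 0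
  modulo the other factors. A new factor \<open>f n\<close> is coprime to the product of the old
  ones; in the Bezout identity one summand becomes \<open>e n\<close>, and the other multiplies the
  old \<open>e l\<close>.\<close>

lemma partial_fraction_idempotents:
  fixes f :: "'b \<Rightarrow> complex poly"
  assumes "finite L" "\<And>l m. l \<in> L \<Longrightarrow> m \<in> L \<Longrightarrow> l \<noteq> m \<Longrightarrow> coprime (f l) (f m)" "L \<noteq> {}"
  obtains e where "(\<Sum>l\<in>L. e l) = 1" "\<And>l. l \<in> L \<Longrightarrow> (\<Prod>m\<in>L - {l}. f m) dvd e l"
proof -
  have "\<exists>e. (\<Sum>l\<in>L. e l) = 1 \<and> (\<forall>l\<in>L. (\<Prod>m\<in>L - {l}. f m) dvd e l)"
    using assms(1,3,2)
  proof (induction L rule: finite_ne_induct)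
    case (singleton l)
    show ?case by (intro exI[of _ "\<lambda>_. 1"]) simp
  next
    case (insert n L)
    then obtain e where e: "(\<Sum>l\<in>L. e l) = 1" "\<And>l. l \<in> L \<Longrightarrow> (\<Prod>m\<in>L - {l}. f m) dvd e l"
      by auto
    have "coprime (f n) (\<Prod>m\<in>L. f m)"
      using insert.prems insert.hyps by (intro prod_coprime_right) auto
    then obtain a b where ab: "a * f n + b * (\<Prod>m\<in>L. f m) = 1"
      using bezout_coefficients_fst_snd[of "f n" "\<Prod>m\<in>L. f m"] by (metis coprime_imp_gcd_eq_1)
    define e' where "e' l = (if l = n then b * (\<Prod>m\<in>L. f m) else a * f n * e l)" for l
    have "(\<Sum>l\<in>L. e' l) = (\<Sum>l\<in>L. a * f n * e l)"
      using insert.hyps by (intro sum.cong) (auto simp: e'_def)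
    then have "(\<Sum>l\<in>insert n L. e' l) = 1"
      using insert.hyps e(1) ab by (simp add: e'_def add.commute flip: sum_distrib_left)
    moreover have "(\<Prod>m\<in>insert n L - {l}. f m) dvd e' l" if l: "l \<in> insert n L" for l
    proof (cases "l = n")
      case True
      then show ?thesis using insert.hyps by (simp add: e'_def)
    next
      case False
      then have "insert n L - {l} = insert n (L - {l})" by auto
      then show ?thesis
        using False insert.hyps e(2)[of l] l
        by (simp add: e'_def mult_dvd_mono)
    qed
    ultimately show ?case by blast
  qed
  then show ?thesis using that by blast
qed

context clinear_op
begin

definition gen_eigenspace :: "complex \<Rightarrow> ('a \<times> 'a) set" where
  "gen_eigenspace l = {v. \<exists>k. poly_op ([:- l, 1:] ^ k) v = 0}"

lemma gen_eigenspace_zero [simp]: "0 \<in> gen_eigenspace l"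
  by (simp add: gen_eigenspace_def)

lemma gen_eigenspace_add:
  assumes "v \<in> gen_eigenspace l" "w \<in> gen_eigenspace l"
  shows "v + w \<in> gen_eigenspace l"
proof -
  obtain j k where "poly_op ([:- l, 1:] ^ j) v = 0" "poly_op ([:- l, 1:] ^ k) w = 0"
    using assms unfolding gen_eigenspace_def by blast
  then have "poly_op ([:- l, 1:] ^ max j k) (v + w) = 0"
    using poly_op_dvd[OF le_imp_power_dvd[OF max.cobounded1]] poly_op_dvd[OF le_imp_power_dvd[OF max.cobounded2]]
    by (simp add: poly_op_add_right)
  then show ?thesis unfolding gen_eigenspace_def by blast
qed

lemma poly_op_linear_factor: "poly_op [:- l, 1:] v = A v - cscale l v"
  by (simp add: scale)

lemma gen_eigenspaceI: "A v - cscale l v \<in> gen_eigenspace l \<Longrightarrow> v \<in> gen_eigenspace l"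
  unfolding gen_eigenspace_def poly_op_linear_factor[symmetric] mem_Collect_eq
  by (metis poly_op_mult power_Suc2)

text \<open>The trace of \<open>A \<circ> T\<close> is the sum of \<open>(cmod l)\<^sup>2\<close> over the eigenvalues \<open>l\<close> of \<open>A\<close>.\<close>

lemma conjugate_eigenvalue_operator:
  obtains T where "linear T" "\<And>c v. T (cscale c v) = cscale c (T v)"
    "\<And>l v. v \<in> gen_eigenspace l \<Longrightarrow> T v = cscale (cnj l) v"
    "\<And>v. \<exists>L f. finite L \<and> (\<forall>l\<in>L. f l \<in> gen_eigenspace l) \<and> v = (\<Sum>l\<in>L. f l)"
    "trace_op (A \<circ> T) = 0 \<Longrightarrow> \<exists>k. \<forall>v. (A ^^ k) v = 0"
proof -
  obtain L N where L: "finite L" "0 \<in> L" and P: "\<And>v. poly_op (\<Prod>l\<in>L. [:- l, 1:] ^ N) v = 0"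
    by (rule annihilator_split) blast
  define P where "P = (\<Prod>l\<in>L. [:- l, 1:] ^ N)"
  have annP: "poly_op p v = 0" if "P dvd p" for p v
    using poly_op_dvd[OF that] P unfolding P_def by blast
  obtain e where e: "(\<Sum>l\<in>L. e l) = 1" "\<And>l. l \<in> L \<Longrightarrow> (\<Prod>m\<in>L - {l}. [:- m, 1:] ^ N) dvd e l"
    using partial_fraction_idempotents[OF L(1), of "\<lambda>l. [:- l, 1:] ^ N"] L(2)
    by (metis (no_types, lifting) coprime_linear_powers empty_iff)
  have P_dvd: "P dvd [:- l, 1:] ^ N * e l" if "l \<in> L" for l
    using mult_dvd_mono[OF dvd_refl e(2)[OF that]] prod.remove[OF L(1) that] by (metis P_def)
  have e_orth: "P dvd e l * e m" if "l \<in> L" "m \<in> L" "l \<noteq> m" for l m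
  proof -
    have "[:- m, 1:] ^ N dvd (\<Prod>m\<in>L - {l}. [:- m, 1:] ^ N)"
      using that L(1) by (intro dvd_prodI) auto
    also have "\<dots> dvd e l" using e(2) that by blast
    finally have "[:- m, 1:] ^ N * e m dvd e l * e m" by (intro mult_dvd_mono dvd_refl)
    then show ?thesis using P_dvd[OF that(2)] dvd_trans by blast
  qed
  have e_idem: "poly_op (e l) (poly_op (e l) v) = poly_op (e l) v" if "l \<in> L" for l v
  proof -
    have "e l - e l * e l = e l * (\<Sum>m\<in>L. e m) - e l * e l"
      by (simp add: e(1))
    also have "\<dots> = (\<Sum>m\<in>L - {l}. e l * e m)"
      using L(1) that by (simp add: sum.remove distrib_left flip: sum_distrib_left)
    finally have "P dvd e l - e l * e l"
      using e_orth that by (auto intro!: dvd_sum)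
    from annP[OF this, of v] show ?thesis by (simp add: poly_op_diff poly_op_mult)
  qed
  have e_mem: "poly_op (e l) v \<in> gen_eigenspace l" if "l \<in> L" for l v
    unfolding gen_eigenspace_def mem_Collect_eq using annP[OF P_dvd[OF that]] by (metis poly_op_mult)
  have e_sum: "v = (\<Sum>l\<in>L. poly_op (e l) v)" for v
    using e(1) by (simp flip: poly_op_sum)
  have e_kill: "poly_op (e m) v = 0" if v: "v \<in> gen_eigenspace l" and m: "m \<in> L" "m \<noteq> l" for l m v
  proof -
    obtain k where k: "poly_op ([:- l, 1:] ^ k) v = 0"
      using v unfolding gen_eigenspace_def by blast
    have "poly_op ([:- l, 1:] ^ k) (poly_op (e m) v) = 0"
      using poly_op_dvd[OF dvd_triv_left k] by (simp flip: poly_op_mult)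
    moreover have "poly_op ([:- m, 1:] ^ N) (poly_op (e m) v) = 0"
      using annP[OF P_dvd[OF m(1)]] by (simp flip: poly_op_mult)
    ultimately show ?thesis
      using poly_op_coprime[OF coprime_linear_powers] m(2) by metis
  qed
  \<comment> \<open>On each generalised eigenspace \<open>t\<close> acts as a scalar: the nilpotent
    part of \<open>A\<close> is discarded and the eigenvalue conjugated.\<close>
  define t where "t = (\<Sum>l\<in>L. smult (cnj l) (e l))"
  \<comment> \<open>For \<open>l\<close> outside \<open>L\<close> every \<open>e m\<close> kills
    \<open>v\<close>, hence \<open>v = 0\<close> and the claim persists.\<close>
  have t_eig: "poly_op t v = cscale (cnj l) v" if v: "v \<in> gen_eigenspace l" for l v
  proof -
    have "poly_op t v = (\<Sum>m\<in>L. cscale (cnj m) (poly_op (e m) v))"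
      by (simp add: t_def poly_op_sum poly_op_smult)
    also have "\<dots> = (\<Sum>m\<in>L. cscale (cnj l) (poly_op (e m) v))"
      using e_kill[OF v] by (intro sum.cong refl) (metis cscale.scale_zero_right)
    also have "\<dots> = cscale (cnj l) v"
      using e_sum[of v] by (simp flip: cscale.scale_sum_right)
    finally show ?thesis .
  qed
  have "\<exists>k. \<forall>v. (A ^^ k) v = 0" if tr: "trace_op (A \<circ> poly_op t) = 0"
  proof -
    \<comment> \<open>On the range of \<open>e l\<close> the operator \<open>A \<circ> T\<close> is
      cnj l (A - l) plus the scalar |l|^2. The first part is nilpotent and contributes no
      trace.\<close>
    have nil: "trace_op (poly_op (smult (cnj l) ([:- l, 1:] * e l))) = 0" if "l \<in> L" for l
    proof (rule trace_op_nilpotent[OF poly_op_linear])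
      fix v
      have "[:- l, 1:] ^ N * e l dvd (smult (cnj l) ([:- l, 1:] * e l)) ^ N" if "N > 0"
      proof -
        have "[:- l, 1:] ^ N * e l dvd [:- l, 1:] ^ N * e l ^ N"
          using that by (intro mult_dvd_mono dvd_refl dvd_power) simp
        also have "\<dots> dvd smult (cnj l ^ N) (([:- l, 1:] * e l) ^ N)"
          unfolding power_mult_distrib by (rule dvd_smult) (rule dvd_refl)
        finally show ?thesis by (simp only: smult_power)
      qed
      then have "P dvd (smult (cnj l) ([:- l, 1:] * e l)) ^ N"
        using P_dvd[OF that] by (cases "N = 0") (auto simp: P_def intro: dvd_trans)
      then show "(poly_op (smult (cnj l) ([:- l, 1:] * e l)) ^^ N) v = 0"
        using annP by (simp flip: poly_op_power)
    qed
    have "poly_op ([:0, 1:] * t) = (\<lambda>v. \<Sum>l\<in>L. poly_op (smult (cnj l) ([:- l, 1:] * e l)) v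
        + (cmod l)\<^sup>2 *\<^sub>R poly_op (e l) v)"
    proof
      fix v
      have "[:0, 1:] * smult (cnj l) (e l)
          = smult (cnj l) ([:- l, 1:] * e l) + smult (complex_of_real ((cmod l)\<^sup>2)) (e l)" for l
        unfolding complex_norm_square by (simp add: smult_diff_right mult.commute)
      then have "[:0, 1:] * t = (\<Sum>l\<in>L. smult (cnj l) ([:- l, 1:] * e l)
          + smult (complex_of_real ((cmod l)\<^sup>2)) (e l))"
        by (simp only: t_def sum_distrib_left)
      then show "poly_op ([:0, 1:] * t) v = (\<Sum>l\<in>L. poly_op (smult (cnj l) ([:- l, 1:] * e l)) v
          + (cmod l)\<^sup>2 *\<^sub>R poly_op (e l) v)"
        by (simp only: poly_op_sum poly_op_add poly_op_smult cscale_of_real)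
    qed
    moreover have "poly_op ([:0, 1:] * t) = A \<circ> poly_op t"
      by (rule ext) (simp only: poly_op_mult, simp)
    ultimately have "trace_op (\<lambda>v. \<Sum>l\<in>L. poly_op (smult (cnj l) ([:- l, 1:] * e l)) v
        + (cmod l)\<^sup>2 *\<^sub>R poly_op (e l) v) = 0"
      using tr by (simp only:)
    then have "(\<Sum>l\<in>L. (cmod l)\<^sup>2 * trace_op (poly_op (e l))) = 0"
      unfolding trace_op_sum trace_op_add trace_op_scaleR using nil by simp
    \<comment> \<open>Idempotents have nonnegative trace, so every term of the sum vanishes; then
      each projection with \<open>l \<noteq> 0\<close> is zero and \<open>e 0\<close> acts as the
      identity.\<close>
    then have "(cmod l)\<^sup>2 * trace_op (poly_op (e l)) = 0" if "l \<in> L" for l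
      using that trace_op_idempotent(1)[OF poly_op_linear e_idem] L(1)
      by (subst (asm) sum_nonneg_eq_0_iff) auto
    then have "poly_op (e l) v = 0" if "l \<in> L" "l \<noteq> 0" for l v
      using that trace_op_idempotent(2)[OF poly_op_linear e_idem] by (metis mult_eq_0_iff norm_eq_zero power_eq_0_iff)
    then have "v = poly_op (e 0) v" for v
      using e_sum[of v] L by (simp add: sum.remove)
    moreover have "poly_op ([:0, 1:] ^ N) (poly_op (e 0) v) = 0" for v
      using annP[OF P_dvd[OF L(2)]] by (simp flip: poly_op_mult)
    moreover have "poly_op [:0, 1:] = A"
      by (rule ext) simp
    ultimately have "(A ^^ N) v = 0" for v
      by (metis poly_op_power)
    then show ?thesis by blast
  qed
  moreover have "\<exists>M f. finite M \<and> (\<forall>l\<in>M. f l \<in> gen_eigenspace l) \<and> v = (\<Sum>l\<in>M. f l)" for v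
    using e_sum[of v] e_mem L(1) by (intro exI[of _ L] exI[of _ "\<lambda>l. poly_op (e l) v"]) blast
  ultimately show ?thesis
    using that[of "poly_op t"] poly_op_linear poly_op_scale_right t_eig by blast
qed

end

section \<open>Lie algebra identities and nilpotency in the Killing radical\<close>

locale lie_alg =
  fixes br :: "'a::euclidean_space \<Rightarrow> 'a \<Rightarrow> 'a"
  assumes lie: "lie_algebra br"
begin

lemma bil: "bilinear br" and alt [simp]: "br x x = 0"
  and jacobi: "br x (br y z) + br y (br z x) + br z (br x y) = 0"
  using lie by (auto simp: lie_algebra_def)

lemmas br_simps = bilinear_ladd[OF bil] bilinear_radd[OF bil] bilinear_lsub[OF bil]
  bilinear_rsub[OF bil] bilinear_lmul[OF bil] bilinear_rmul[OF bil] bilinear_lneg[OF bil]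
  bilinear_rneg[OF bil]

lemma br_zero [simp]: "br 0 y = 0" "br x 0 = 0"
  using bilinear_lzero[OF bil] bilinear_rzero[OF bil] by auto

lemma linear_right: "linear (br x)" and linear_left: "linear (\<lambda>x. br x y)"
  using bil by (auto simp: bilinear_def)

lemma antisym: "br x y = - br y x"
  using alt[of "x + y"] alt[of x] alt[of y]
  by (simp add: br_simps eq_neg_iff_add_eq_0 add.commute del: alt)

lemma leibniz: "br x (br y z) = br (br x y) z + br y (br x z)"
  using jacobi[of x y z] antisym[of z "br x y"] antisym[of z x]
  by (simp add: br_simps algebra_simps eq_neg_iff_add_eq_0)

lemma br_br: "br (br x y) z = br x (br y z) - br y (br x z)"
  using leibniz[of x y z] by simp

lemma bounded_bilinear_br: "bounded_bilinear br"
  using bil by (simp add: bilinear_conv_bounded_bilinear)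

lemma killing_commute: "killing br x y = killing br y x"
  unfolding killing_def by (intro trace_op_comm linear_right)

lemma killing_linear_right: "linear (killing br x)"
  by (rule linearI)
    (simp_all add: killing_def trace_op_def br_simps inner_add_left sum.distrib sum_distrib_left)

lemma killing_linear_left: "linear (\<lambda>x. killing br x y)"
  by (subst killing_commute) (rule killing_linear_right)

lemmas killing_simps =
  linear_add[OF killing_linear_right] linear_diff[OF killing_linear_right]
  linear_cmul[OF killing_linear_right] linear_neg[OF killing_linear_right]
  linear_0[OF killing_linear_right] linear_add[OF killing_linear_left]
  linear_diff[OF killing_linear_left] linear_cmul[OF killing_linear_left]
  linear_neg[OF killing_linear_left] linear_0[OF killing_linear_left]

lemma killing_br: "killing br x (br y z) = killing br (br x y) z"
  by (rule killing_invariant[OF lie])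

text \<open>The complex bilinear extension of \<open>br\<close> to pairs.\<close>

definition cbr :: "'a \<times> 'a \<Rightarrow> 'a \<times> 'a \<Rightarrow> 'a \<times> 'a" where
  "cbr u v = (br (fst u) (fst v) - br (snd u) (snd v), br (fst u) (snd v) + br (snd u) (fst v))"

lemma cbr_add_left: "cbr (u + v) w = cbr u w + cbr v w"
  and cbr_add_right: "cbr w (u + v) = cbr w u + cbr w v"
  and cbr_scale_left: "cbr (cscale c u) v = cscale c (cbr u v)"
  and cbr_scale_right: "cbr u (cscale c v) = cscale c (cbr u v)"
  by (simp_all add: cbr_def cscale_def br_simps scaleR_add_right scaleR_diff_right)

lemma linear_cbr_right: "linear (cbr u)" and linear_cbr_left: "linear (\<lambda>u. cbr u v)"
  by (rule linearI,
      simp_all only: cbr_add_left cbr_add_right cbr_scale_left cbr_scale_right cscale_of_real[symmetric])+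

lemma cbr_zero [simp]: "cbr 0 v = 0" "cbr u 0 = 0"
  by (simp_all add: cbr_def prod_eq_iff)

lemma cbr_jacobi: "cbr (x, 0) (cbr u v) = cbr (cbr (x, 0) u) v + cbr u (cbr (x, 0) v)"
  by (simp add: cbr_def br_simps leibniz[of x])

lemma clinear_op_cbr: "clinear_op (cbr (x, 0))"
  by unfold_locales (simp_all add: cbr_add_right cbr_scale_right)

text \<open>By the Jacobi identity, ad x - (l + m) sends [u, v] to [(ad x - l) u, v] +
  [u, (ad x - m) v]; each summand lowers one of the two exponents, so induction on a bound for their
  sum applies.\<close>

lemma cbr_gen_eigenspace:
  assumes "u \<in> clinear_op.gen_eigenspace (cbr (x, 0)) l" "v \<in> clinear_op.gen_eigenspace (cbr (x, 0)) m"
  shows "cbr u v \<in> clinear_op.gen_eigenspace (cbr (x, 0)) (l + m)"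
proof -
  interpret A: clinear_op "cbr (x, 0)" by (rule clinear_op_cbr)
  have "cbr u v \<in> A.gen_eigenspace (l + m)"
    if "A.poly_op ([:- l, 1:] ^ j) u = 0" "A.poly_op ([:- m, 1:] ^ k) v = 0" "j + k \<le> n" for j k n u v
    using that
  proof (induction n arbitrary: j k u v)
    case 0
    then show ?case by simp
  next
    case (Suc n)
    show ?case
    proof (cases "j = 0 \<or> k = 0")
      case True
      then show ?thesis
        using Suc.prems by auto
    next
      case False
      then obtain j' k' where jk: "j = Suc j'" "k = Suc k'" by (metis not0_implies_Suc)
      define u' where "u' = cbr (x, 0) u - cscale l u"
      define v' where "v' = cbr (x, 0) v - cscale m v"
      have u': "A.poly_op ([:- l, 1:] ^ j') u' = 0"
        using Suc.prems(1) unfolding jk u'_def A.poly_op_linear_factor[symmetric] power_Suc2 A.poly_op_mult .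
      have v': "A.poly_op ([:- m, 1:] ^ k') v' = 0"
        using Suc.prems(2) unfolding jk v'_def A.poly_op_linear_factor[symmetric] power_Suc2 A.poly_op_mult .
      have "cbr u' v \<in> A.gen_eigenspace (l + m)" "cbr u v' \<in> A.gen_eigenspace (l + m)"
        using Suc.IH[OF u' Suc.prems(2)] Suc.IH[OF Suc.prems(1) v'] Suc.prems(3) jk by auto
      moreover have "cbr (x, 0) (cbr u v) - cscale (l + m) (cbr u v) = cbr u' v + cbr u v'"
        by (simp add: u'_def v'_def cbr_jacobi linear_diff[OF linear_cbr_left]
            linear_diff[OF linear_cbr_right] cbr_scale_left cbr_scale_right cscale.scale_left_distrib)
      ultimately show ?thesis
        using A.gen_eigenspace_add A.gen_eigenspaceI by metis
    qed
  qed
  with assms show ?thesis unfolding A.gen_eigenspace_def by blast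
qed

text \<open>A real trace on pairs is twice the real part of the complex trace, which for v = a + i b
  is \<kappa>(y, a) + i \<kappa>(y, b).\<close>

lemma trace_op_cbr_cbr: "trace_op (cbr (y, 0) \<circ> cbr v) = 2 * killing br y (fst v)"
proof -
  have eq: "trace_op f = (\<Sum>b\<in>Basis. fst (f (b, 0)) \<bullet> b) + (\<Sum>b\<in>Basis. snd (f (0, b)) \<bullet> b)"
    for f :: "'a \<times> 'a \<Rightarrow> 'a \<times> 'a"
    unfolding trace_op_def Basis_prod_def
    by (subst sum.union_disjoint) (auto simp: sum.reindex inj_on_def inner_prod_def)
  show ?thesis
    unfolding eq by (simp add: cbr_def killing_def trace_op_def)
qed

text \<open>With \<open>T\<close> the conjugate of the semisimple part of \<open>ad x\<close>, which is a derivation of the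
  complexification, invariance turns \<open>tr (ad [y, z] T)\<close> into \<open>- tr (ad y ad (T z)) = 0\<close>.\<close>

lemma lie_nilpotent_of_killing_radical:
  assumes P: "\<And>y z. y \<in> P \<Longrightarrow> killing br y z = 0"
    and x: "x \<in> span {br y z | y z. y \<in> P \<and> z \<in> P}"
  shows "lie_nilpotent br x"
proof -
  interpret A: clinear_op "cbr (x, 0)" by (rule clinear_op_cbr)
  obtain T where T: "linear T" "\<And>c v. T (cscale c v) = cscale c (T v)"
    "\<And>l v. v \<in> A.gen_eigenspace l \<Longrightarrow> T v = cscale (cnj l) v"
    "\<And>v. \<exists>L f. finite L \<and> (\<forall>l\<in>L. f l \<in> A.gen_eigenspace l) \<and> v = (\<Sum>l\<in>L. f l)"
    "trace_op (cbr (x, 0) \<circ> T) = 0 \<Longrightarrow> \<exists>k. \<forall>v. (cbr (x, 0) ^^ k) v = 0"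
    by (rule A.conjugate_eigenvalue_operator) blast
  \<comment> \<open>On generalised eigenvectors this is the additivity of conjugation, as the
    bracket lies in the space of \<open>l + m\<close>; bilinearity gives the rest.\<close>
  have der: "T (cbr u v) = cbr (T u) v + cbr u (T v)" for u v
  proof -
    obtain L f where L: "finite L" "\<And>l. l \<in> L \<Longrightarrow> f l \<in> A.gen_eigenspace l" "u = (\<Sum>l\<in>L. f l)"
      using T(4) by metis
    obtain M g where M: "finite M" "\<And>l. l \<in> M \<Longrightarrow> g l \<in> A.gen_eigenspace l" "v = (\<Sum>l\<in>M. g l)"
      using T(4) by metis
    have fg: "T (cbr (f l) (g m)) = cbr (T (f l)) (g m) + cbr (f l) (T (g m))"
      if "l \<in> L" "m \<in> M" for l m
      using T(3)[OF cbr_gen_eigenspace[OF L(2) M(2)]] T(3)[OF L(2)] T(3)[OF M(2)] that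
      by (simp add: cscale.scale_left_distrib cbr_scale_left cbr_scale_right)
    show ?thesis
      unfolding L(3) M(3)
      by (simp add: linear_sum[OF linear_cbr_left] linear_sum[OF linear_cbr_right] linear_sum[OF T(1)]
          fg sum.distrib)
  qed
  have "trace_op (cbr (w, 0) \<circ> T) = 0" if "w \<in> span {br y z | y z. y \<in> P \<and> z \<in> P}" for w
    using that
  proof (induction rule: span_induct_alt)
    case base
    then show ?case by (simp add: trace_op_def flip: zero_prod_def)
  next
    case (step c w v)
    then obtain y z where yz: "w = br y z" "y \<in> P" "z \<in> P" by blast
    have "trace_op (cbr (w, 0) \<circ> T) = 0"
    proof -
      have w: "cbr (w, 0) v = cbr (y, 0) (cbr (z, 0) v) - cbr (z, 0) (cbr (y, 0) v)" for v
        by (simp add: yz cbr_def br_br br_simps)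
      have "trace_op (cbr (w, 0) \<circ> T) + trace_op (cbr (z, 0) \<circ> (cbr (y, 0) \<circ> T))
          = trace_op (cbr (y, 0) \<circ> (cbr (z, 0) \<circ> T))"
        by (simp add: comp_def w flip: trace_op_add)
      moreover have "trace_op (cbr (z, 0) \<circ> (cbr (y, 0) \<circ> T)) = trace_op ((cbr (y, 0) \<circ> T) \<circ> cbr (z, 0))"
        by (intro trace_op_comm linear_compose linear_cbr_right T)
      \<comment> \<open>Here the derivation rule is applied to T [z, v].\<close>
      moreover have "trace_op ((cbr (y, 0) \<circ> T) \<circ> cbr (z, 0))
          = trace_op (cbr (y, 0) \<circ> (cbr (z, 0) \<circ> T)) + trace_op (cbr (y, 0) \<circ> cbr (T (z, 0)))"
        unfolding comp_def der linear_add[OF linear_cbr_right] trace_op_add by simp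
      \<comment> \<open>\<open>T (z, 0)\<close> need not be real, but the trace sees only its first
        component, which pairs to zero with \<open>y\<close>.\<close>
      moreover have "trace_op (cbr (y, 0) \<circ> cbr (T (z, 0))) = 0"
        using P yz(2) by (simp add: trace_op_cbr_cbr)
      ultimately show ?thesis by simp
    qed
    moreover have "cbr (c *\<^sub>R w + v, 0) u = c *\<^sub>R cbr (w, 0) u + cbr (v, 0) u" for u
      by (simp add: cbr_def br_simps prod_eq_iff)
    ultimately show ?case
      using step.IH by (simp add: comp_def trace_op_add trace_op_scaleR)
  qed
  then obtain k where k: "\<And>v. (cbr (x, 0) ^^ k) v = 0" using T(5) x by blast
  have "(cbr (x, 0) ^^ k) (y, 0) = ((br x ^^ k) y, 0)" for y
    by (induction k) (simp_all add: cbr_def)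
  then show ?thesis
    unfolding lie_nilpotent_def using k by (metis prod.inject zero_prod_def)
qed

end

section \<open>Engel's theorem\<close>

lemma maximal_dim_exists:
  fixes X :: "'a::euclidean_space set \<Rightarrow> bool"
  assumes "X M"
  obtains M where "X M" "\<And>M'. X M' \<Longrightarrow> dim M' \<le> dim M"
  using ex_has_greatest_nat[of X M dim "Suc DIM('a)"] assms dim_subset_UNIV
  by (metis less_Suc_eq_le)

context lie_alg
begin

text \<open>The pair \<open>U\<close>, \<open>W\<close> stands for the module W/U. This relative
  form lets the induction on \<open>dim L\<close> use the same statement for a subalgebra M acting
  on L/M and on W/U.\<close>

lemma engel:
  assumes "subspace L" "\<And>a b. a \<in> L \<Longrightarrow> b \<in> L \<Longrightarrow> br a b \<in> L" "\<And>a. a \<in> L \<Longrightarrow> lie_nilpotent br a"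
    and "subspace U" "subspace W" "U \<subset> W"
    and "\<And>a w. a \<in> L \<Longrightarrow> w \<in> W \<Longrightarrow> br a w \<in> W" "\<And>a w. a \<in> L \<Longrightarrow> w \<in> U \<Longrightarrow> br a w \<in> U"
  shows "\<exists>w\<in>W - U. \<forall>a\<in>L. br a w \<in> U"
  using assms
proof (induction "dim L" arbitrary: L U W rule: less_induct)
  case less
  note L = less.prems(1-3) and UW = less.prems(4-8)
  show ?case
  proof (cases "L = {0}")
    case True
    then show ?thesis using UW subspace_0[OF UW(1)] by auto
  next
    case False
    \<comment> \<open>A proper subalgebra of maximal dimension will turn out to have codimension
      one.\<close>
    define X where "X M \<longleftrightarrow> subspace M \<and> M \<subset> L \<and> (\<forall>a\<in>M. \<forall>b\<in>M. br a b \<in> M)" for M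
    have "X {0}"
      using False subspace_0[OF L(1)] by (auto simp: X_def)
    then obtain M where M: "X M" "\<And>M'. X M' \<Longrightarrow> dim M' \<le> dim M"
      by (rule maximal_dim_exists) blast
    then have subM: "subspace M" "M \<subset> L" "\<And>a b. a \<in> M \<Longrightarrow> b \<in> M \<Longrightarrow> br a b \<in> M"
      by (auto simp: X_def)
    have "dim M < dim L"
      using subM(1,2) L(1) by (intro dim_psubset) (simp add: span_eq_iff[THEN iffD2])
    note IH = less.hyps[OF this subM(1,3)]
    \<comment> \<open>The induction hypothesis for \<open>M\<close> acting on L/M yields
      \<open>z\<close> normalising \<open>M\<close>; then M + R z is a larger subalgebra, hence all
      of \<open>L\<close>.\<close>
    have "\<exists>w\<in>L - M. \<forall>a\<in>M. br a w \<in> M"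
      using L subM by (intro IH) blast+
    then obtain z where z: "z \<in> L" "z \<notin> M" "\<And>a. a \<in> M \<Longrightarrow> br a z \<in> M" by blast
    have zM: "br z a \<in> M" if "a \<in> M" for a
      using z(3)[OF that] antisym[of z a] subspace_neg[OF subM(1)] by metis
    define M' where "M' = span (insert z M)"
    have M'_iff: "a \<in> M' \<longleftrightarrow> (\<exists>c. a - c *\<^sub>R z \<in> M)" for a
      using subM(1) by (simp add: M'_def span_breakdown_eq span_eq_iff[THEN iffD2])
    have "M' \<subseteq> L"
      unfolding M'_def using z(1) subM(2) L(1) by (intro span_minimal) auto
    have "br a b \<in> M'" if ab: "a \<in> M'" "b \<in> M'" for a b
    proof -
      obtain c d where cd: "a - c *\<^sub>R z \<in> M" "b - d *\<^sub>R z \<in> M"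
        using ab M'_iff by blast
      have "br a b = br (a - c *\<^sub>R z) (b - d *\<^sub>R z) + c *\<^sub>R br z (b - d *\<^sub>R z) + d *\<^sub>R br (a - c *\<^sub>R z) z"
        by (simp add: br_simps algebra_simps)
      also have "\<dots> \<in> M"
        using cd subM z(3) zM by (intro subspace_add subspace_scale) auto
      finally show ?thesis unfolding M'_iff by (intro exI[of _ 0]) simp
    qed
    moreover have "dim M < dim M'"
    proof (rule dim_psubset)
      have "z \<in> M'" "M \<subseteq> M'" unfolding M'_def by (auto intro: span_base)
      then show "span M \<subset> span M'"
        using z(2) subM(1) by (simp add: M'_def span_eq_iff[THEN iffD2] psubset_eq) blast
    qed
    ultimately have "M' = L"
      using M(2)[of M'] \<open>M' \<subseteq> L\<close> by (auto simp: X_def M'_def)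
    have "\<exists>w\<in>W - U. \<forall>a\<in>M. br a w \<in> U"
      using L subM UW by (intro IH) blast+
    then obtain w where w: "w \<in> W" "w \<notin> U" "\<And>a. a \<in> M \<Longrightarrow> br a w \<in> U" by blast
    \<comment> \<open>The vectors killed by \<open>M\<close> modulo \<open>U\<close>; they are
      stable under ad z because \<open>z\<close> normalises \<open>M\<close>.\<close>
    define W0 where "W0 = {w \<in> W. \<forall>a\<in>M. br a w \<in> U}"
    have "br z v \<in> W0" if "v \<in> W0" for v
    proof -
      have "br a (br z v) \<in> U" if "a \<in> M" for a
      proof -
        have "br (br a z) v \<in> U" "br a v \<in> U"
          using \<open>v \<in> W0\<close> that z(3) by (auto simp: W0_def)
        then show ?thesis
          using subspace_add[OF UW(1)] UW(5)[OF z(1)] by (simp add: leibniz[of a z])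
      qed
      then show ?thesis using that UW(4) z(1) by (auto simp: W0_def)
    qed
    then have W0: "(br z ^^ k) w \<in> W0" for k
      using w by (induction k) (auto simp: W0_def)
    \<comment> \<open>The last iterate outside \<open>U\<close> is killed modulo \<open>U\<close> by
      \<open>z\<close> as well as by \<open>M\<close>.\<close>
    define k where "k = (LEAST k. (br z ^^ k) w \<in> U)"
    obtain n where "(br z ^^ n) w = 0"
      using L(3)[OF z(1)] by (auto simp: lie_nilpotent_def)
    then have "(br z ^^ n) w \<in> U" using subspace_0[OF UW(1)] by simp
    then have k: "(br z ^^ k) w \<in> U" "\<And>j. j < k \<Longrightarrow> (br z ^^ j) w \<notin> U"
      unfolding k_def by (rule LeastI) (rule not_less_Least)
    have "k \<noteq> 0" using k(1) w(2) by (metis funpow_0)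
    then obtain j where j: "k = Suc j" by (metis not0_implies_Suc)
    define v where "v = (br z ^^ j) w"
    have v: "v \<in> W0" "v \<notin> U" "br z v \<in> U"
      using W0[of j] k(1) k(2)[of j] by (simp_all add: v_def j)
    have "br a v \<in> U" if a: "a \<in> L" for a
    proof -
      obtain c where c: "a - c *\<^sub>R z \<in> M" using \<open>M' = L\<close> a M'_iff by blast
      have "br a v = br (a - c *\<^sub>R z) v + c *\<^sub>R br z v" by (simp add: br_simps)
      also have "\<dots> \<in> U"
        using c v UW(1) by (intro subspace_add subspace_scale) (auto simp: W0_def)
      finally show ?thesis .
    qed
    then show ?thesis using v by (auto simp: W0_def)
  qed
qed

text \<open>Take a proper invariant subspace \<open>U\<close> of maximal dimension. Engel on P/U
  gives \<open>w\<close> with [P, w] in \<open>U\<close>; maximality forces U + R w = P, so [P, P]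
  lies in \<open>U\<close>.\<close>

lemma derived_subalgebra_proper:
  assumes P: "subspace P" "\<And>a b. a \<in> P \<Longrightarrow> b \<in> P \<Longrightarrow> br a b \<in> P" "\<And>a. a \<in> P \<Longrightarrow> lie_nilpotent br a"
    and "P \<noteq> {0}"
  shows "span {br a b | a b. a \<in> P \<and> b \<in> P} \<noteq> P"
proof -
  define X where "X U \<longleftrightarrow> subspace U \<and> U \<subset> P \<and> (\<forall>a\<in>P. \<forall>b\<in>U. br a b \<in> U)" for U
  have "X {0}"
    using assms(4) subspace_0[OF P(1)] by (auto simp: X_def)
  then obtain U where U: "X U" "\<And>U'. X U' \<Longrightarrow> dim U' \<le> dim U"
    by (rule maximal_dim_exists) blast
  then have UP: "subspace U" "U \<subset> P" "\<And>a b. a \<in> P \<Longrightarrow> b \<in> U \<Longrightarrow> br a b \<in> U"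
    by (auto simp: X_def)
  have "\<exists>w\<in>P - U. \<forall>a\<in>P. br a w \<in> U"
    using P UP by (intro engel) blast+
  then obtain w where w: "w \<in> P" "w \<notin> U" "\<And>a. a \<in> P \<Longrightarrow> br a w \<in> U" by blast
  define V where "V = span (insert w U)"
  have brV: "br a b \<in> U" if ab: "a \<in> P" "b \<in> V" for a b
  proof -
    obtain c where c: "b - c *\<^sub>R w \<in> U"
      using ab(2) UP(1) by (auto simp: V_def span_breakdown_eq span_eq_iff[THEN iffD2])
    have "br a b = br a (b - c *\<^sub>R w) + c *\<^sub>R br a w" by (simp add: br_simps)
    also have "\<dots> \<in> U"
      using ab(1) c UP(1,3) w(3) by (intro subspace_add subspace_scale) auto
    finally show ?thesis .
  qed
  have V: "w \<in> V" "U \<subseteq> V" unfolding V_def by (auto intro: span_base)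
  have "V \<subseteq> P"
    unfolding V_def using w(1) UP(2) P(1) by (intro span_minimal) auto
  have "dim U < dim V"
    using V w(2) UP(1) by (intro dim_psubset) (simp add: V_def span_eq_iff[THEN iffD2] psubset_eq, blast)
  then have "V = P"
  proof -
    have "\<not> X V" using U(2)[of V] \<open>dim U < dim V\<close> by linarith
    moreover have "\<forall>a\<in>P. \<forall>b\<in>V. br a b \<in> V" using brV V(2) by blast
    ultimately show ?thesis using \<open>V \<subseteq> P\<close> by (simp add: X_def V_def psubset_eq)
  qed
  then have "span {br a b | a b. a \<in> P \<and> b \<in> P} \<subseteq> U"
    using brV UP(1) by (intro span_minimal) auto
  then show ?thesis using UP(2) by blast
qed

section \<open>Nondegeneracy of the Killing form and the element h\<close>

lemma lie_ideal_derived_series: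
  assumes "lie_ideal br I"
  shows "lie_ideal br (derived_series br I k)"
proof (induction k)
  case 0
  then show ?case using assms by simp
next
  case (Suc k)
  let ?B = "{br a b | a b. a \<in> derived_series br I k \<and> b \<in> derived_series br I k}"
  have "br x y \<in> span ?B" if "y \<in> span ?B" for x y
    using that
  proof (induction rule: span_induct_alt)
    case base
    then show ?case by (simp add: span_zero)
  next
    case (step c u v)
    then obtain a b where ab: "u = br a b" "a \<in> derived_series br I k" "b \<in> derived_series br I k"
      by blast
    then have "br x a \<in> derived_series br I k" "br x b \<in> derived_series br I k"
      using Suc.IH by (auto simp: lie_ideal_def)
    then have "br (br x a) b \<in> span ?B" "br a (br x b) \<in> span ?B"
      using ab(2,3) by (blast intro: span_base)+
    then have "br x u \<in> span ?B"
      unfolding ab(1) by (subst leibniz) (rule span_add)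
    then show ?case
      using step.IH by (simp add: br_simps span_add span_scale)
  qed
  then show ?case by (simp add: lie_ideal_def)
qed

lemma derived_series_Suc_subset:
  assumes "lie_ideal br I"
  shows "derived_series br I (Suc k) \<subseteq> derived_series br I k"
  unfolding derived_series.simps using lie_ideal_derived_series[OF assms, of k]
  by (intro span_minimal) (auto simp: lie_ideal_def)

text \<open>ad x and ad z commute, so their product inherits nilpotency from ad x and has trace
  zero.\<close>

lemma killing_eq_0_if_commute:
  assumes "lie_nilpotent br x" "br x z = 0"
  shows "killing br x z = 0"
proof -
  have comm: "br x (br z w) = br z (br x w)" for w
    using leibniz[of x z w] assms(2) by simp
  have comm_pow: "(br x ^^ k) (br z w) = br z ((br x ^^ k) w)" for k w
    by (induction k) (simp_all add: comm)
  have pow: "((br x \<circ> br z) ^^ k) w = (br x ^^ k) ((br z ^^ k) w)" for k w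
    by (induction k) (simp_all add: comm_pow)
  obtain k where "\<And>y. (br x ^^ k) y = 0"
    using assms(1) by (auto simp: lie_nilpotent_def)
  then show ?thesis
    unfolding killing_def
    by (intro trace_op_nilpotent[of _ k] linear_compose linear_right) (simp add: pow)
qed

end

locale semisimple_lie_alg =
  fixes br :: "'a::euclidean_space \<Rightarrow> 'a \<Rightarrow> 'a"
  assumes semisimple: "semisimple_lie_algebra br"

sublocale semisimple_lie_alg \<subseteq> lie_alg
  using semisimple by unfold_locales (simp add: semisimple_lie_algebra_def)

context semisimple_lie_alg
begin

lemma killing_nondegenerate:
  assumes "\<And>y. killing br x y = 0"
  shows "x = 0"
proof -
  define R where "R = {x. \<forall>y. killing br x y = 0}"
  have "killing br (br x y) z = 0" if "y \<in> R" for x y z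
    using that killing_br[of y x z] antisym[of x y] by (simp add: R_def killing_simps)
  then have R: "lie_ideal br R"
    by (auto simp: lie_ideal_def R_def subspace_def killing_simps)
  let ?D = "derived_series br R"
  have ideal: "lie_ideal br (?D k)" for k
    by (rule lie_ideal_derived_series[OF R])
  \<comment> \<open>A term of least dimension equals its successor, so it is the perfect ideal P:
    each of its elements is a sum of brackets from P.\<close>
  obtain k where k: "\<And>j. dim (?D k) \<le> dim (?D j)"
    using ex_has_least_nat[of "\<lambda>_. True" 0 "\<lambda>k. dim (?D k)"] by blast
  have P: "subspace (?D k)" using ideal[of k] by (simp add: lie_ideal_def)
  have Suc: "?D (Suc k) = ?D k"
    using derived_series_Suc_subset[OF R, of k] ideal k
    by (intro subspace_dim_equal) (auto simp: lie_ideal_def simp del: derived_series.simps)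
  have "?D k \<subseteq> R"
  proof (induction k)
    case (Suc k)
    then show ?case using derived_series_Suc_subset[OF R, of k] by blast
  qed simp
  then have nil: "lie_nilpotent br a" if "a \<in> ?D k" for a
    using that Suc by (intro lie_nilpotent_of_killing_radical[of "?D k"]) (auto simp: R_def)
  have "?D k = {0}"
  proof (rule ccontr)
    assume "?D k \<noteq> {0}"
    then have "?D (Suc k) \<noteq> ?D k"
      unfolding derived_series.simps
      using ideal[of k] nil by (intro derived_subalgebra_proper P) (auto simp: lie_ideal_def)
    then show False using Suc by simp
  qed
  then have "R = {0}"
    using R semisimple unfolding semisimple_lie_algebra_def by blast
  then show ?thesis using assms by (auto simp: R_def)
qed

text \<open>Nondegeneracy makes the map from \<open>z\<close> to its functional injective, hence
  surjective by dimension. This converts euclidean orthogonality into Killing orthogonality.\<close>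

lemma killing_represents:
  obtains z where "\<And>y. killing br z y = v \<bullet> y"
proof -
  define J where "J z = (\<Sum>b\<in>Basis. killing br z b *\<^sub>R b)" for z
  have J: "J z \<bullet> y = killing br z y" for z y
  proof -
    have "killing br z y = killing br z (\<Sum>b\<in>Basis. (y \<bullet> b) *\<^sub>R b)"
      by (simp add: euclidean_representation)
    then show ?thesis
      by (simp add: J_def linear_sum[OF killing_linear_right] killing_simps inner_sum_left
          inner_commute[of y] mult.commute)
  qed
  have lin: "linear J"
    unfolding J_def by (intro linearI) (simp_all add: killing_simps scaleR_add_left sum.distrib scaleR_right.sum)
  have "z = 0" if "J z = 0" for z
    using that J[of z] killing_nondegenerate[of z] by simp
  then have "inj J" using lin by (simp add: linear_injective_0)
  then have "surj J" using lin by (simp add: linear_injective_imp_surjective)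
  then obtain z where "J z = v" by (metis surjD)
  then show ?thesis using that[of z] J[of z] by simp
qed

text \<open>The image of \<open>ad x\<close> is the Killing complement of its kernel, and \<open>x\<close> lies in the latter by
  \<open>killing_eq_0_if_commute\<close>.\<close>

lemma eigenvector_of_nilpotent:
  assumes "lie_nilpotent br x"
  obtains h where "br h x = x"
proof -
  have "x \<in> range (br x)"
  proof (rule ccontr)
    assume x: "x \<notin> range (br x)"
    have sub: "subspace (range (br x))"
      using linear_right by (simp add: linear_subspace_image)
    obtain y v where yv: "y \<in> span (range (br x))" "\<And>w. w \<in> span (range (br x)) \<Longrightarrow> orthogonal v w" "x = y + v"
      using orthogonal_subspace_decomp_exists[of "range (br x)" x] by blast
    have "y \<in> range (br x)" using yv(1) sub by (simp add: span_eq_iff[THEN iffD2])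
    then have "v \<noteq> 0" using x yv(3) by auto
    \<comment> \<open>The functional of \<open>v\<close> vanishes on the image of ad x; by
      invariance [z, x] is then in the Killing radical.\<close>
    obtain z where z: "\<And>y. killing br z y = v \<bullet> y" by (rule killing_represents) blast
    have "killing br (br z x) w = 0" for w
      using yv(2)[of "br x w"] z[of "br x w"] killing_br[of z x w]
      by (simp add: orthogonal_def span_base)
    then have "br z x = 0" by (rule killing_nondegenerate)
    then have "killing br x z = 0"
      using antisym[of x z] by (intro killing_eq_0_if_commute assms) simp
    then have "v \<bullet> x = 0" using z killing_commute by metis
    moreover have "v \<bullet> y = 0" using yv(1,2) by (simp add: orthogonal_def)
    ultimately show False using yv(3) \<open>v \<noteq> 0\<close> by (simp add: inner_add_right)
  qed
  then obtain y where "x = br x y" by blast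
  \<comment> \<open>x = [x, y] = [- y, x].\<close>
  then show ?thesis using that[of "- y"] antisym[of x y] by (simp add: br_simps)
qed

end

section \<open>The exponential of ad X and the adjoint group\<close>

context lie_alg
begin

lemma exp_ad_summable: "summable (\<lambda>n. (br X ^^ n) y /\<^sub>R fact n)"
proof -
  obtain K where K: "\<And>y. norm (br X y) \<le> K * norm y" "K > 0"
    using linear_bounded_pos[OF linear_right] by metis
  have le: "norm ((br X ^^ n) y) \<le> K ^ n * norm y" for n
  proof (induction n)
    case (Suc n)
    have "norm ((br X ^^ Suc n) y) \<le> K * norm ((br X ^^ n) y)" by (simp add: K(1))
    also have "\<dots> \<le> K * (K ^ n * norm y)" using Suc K(2) by (intro mult_left_mono) auto
    finally show ?case by (simp add: mult.assoc)
  qed simp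
  have "summable (\<lambda>n. norm y * (inverse (fact n) * K ^ n))"
    by (intro summable_mult summable_exp)
  then show ?thesis
  proof (rule summable_comparison_test')
    fix n :: nat
    show "norm ((br X ^^ n) y /\<^sub>R fact n) \<le> norm y * (inverse (fact n) * K ^ n)"
      using le[of n] by (simp add: field_simps)
  qed
qed

lemma exp_ad_sums: "(\<lambda>n. (br X ^^ n) y /\<^sub>R fact n) sums exp_ad br X y"
  unfolding exp_ad_def by (rule summable_sums[OF exp_ad_summable])

lemma funpow_br_linear: "linear (br X ^^ n)"
proof (induction n)
  case (Suc n)
  then show ?case using linear_compose[OF Suc linear_right] by (simp add: comp_def)
qed (simp add: linear_ident)

lemma linear_exp_ad: "linear (exp_ad br X)"
proof (rule linearI)
  fix y z :: 'a and c :: real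
  note L = linear_add[OF funpow_br_linear] linear_cmul[OF funpow_br_linear]
  show "exp_ad br X (y + z) = exp_ad br X y + exp_ad br X z"
    using sums_unique2[OF exp_ad_sums[of X "y + z"]] sums_add[OF exp_ad_sums[of X y] exp_ad_sums[of X z]]
    by (simp add: L scaleR_add_right)
  show "exp_ad br X (c *\<^sub>R y) = c *\<^sub>R exp_ad br X y"
    using sums_unique2[OF exp_ad_sums[of X "c *\<^sub>R y"]] sums_scaleR_right[OF exp_ad_sums[of X y], of c]
    by (simp add: L mult.commute)
qed

lemma exp_ad_br: "exp_ad br X (br X y) = br X (exp_ad br X y)"
proof -
  have "(\<lambda>n. br X ((br X ^^ n) y /\<^sub>R fact n)) sums br X (exp_ad br X y)"
    using bounded_linear.sums[OF _ exp_ad_sums] linear_right linear_conv_bounded_linear by blast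
  then show ?thesis
    using exp_ad_sums[of X "br X y"] by (intro sums_unique2) (simp_all add: br_simps funpow_swap1)
qed

lemma exp_ad_0 [simp]: "exp_ad br 0 y = y"
proof -
  have "(br 0 ^^ n) y /\<^sub>R fact n = 0" if "n \<notin> {0}" for n
    using that by (cases n) auto
  then show ?thesis
    unfolding exp_ad_def by (subst suminf_finite[of "{0}"]) auto
qed

lemma exp_ad_eigenvector:
  assumes "br h x = x"
  shows "exp_ad br (s *\<^sub>R h) x = exp s *\<^sub>R x"
proof -
  have "(br (s *\<^sub>R h) ^^ n) x = s ^ n *\<^sub>R x" for n
    by (induction n) (simp_all add: br_simps assms)
  then have "(\<lambda>n. (s ^ n /\<^sub>R fact n) *\<^sub>R x) sums exp_ad br (s *\<^sub>R h) x"
    using exp_ad_sums[of "s *\<^sub>R h" x] by (simp add: mult.commute)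
  moreover have "(\<lambda>n. (s ^ n /\<^sub>R fact n) *\<^sub>R x) sums (exp s *\<^sub>R x)"
    by (intro sums_scaleR_left exp_converges)
  ultimately show ?thesis by (rule sums_unique2)
qed

text \<open>Each component is an everywhere convergent real power series in \<open>t\<close>;
  termwise differentiation shifts its coefficients to those belonging to
  \<open>br X y\<close>.\<close>

lemma exp_ad_has_vector_derivative:
  "((\<lambda>t. exp_ad br (t *\<^sub>R X) y) has_vector_derivative exp_ad br (t *\<^sub>R X) (br X y)) (at t)"
proof -
  have pow: "(br (t *\<^sub>R X) ^^ n) y = t ^ n *\<^sub>R (br X ^^ n) y" for n t y
    by (induction n) (simp_all add: br_simps)
  have comp: "((\<lambda>t. exp_ad br (t *\<^sub>R X) y \<bullet> b) has_real_derivative exp_ad br (t *\<^sub>R X) (br X y) \<bullet> b) (at t)" for b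
  proof -
    define c where "c n = (br X ^^ n) y \<bullet> b / fact n" for n
    have sums: "(\<lambda>n. (br X ^^ n) y \<bullet> b / fact n * t ^ n) sums (exp_ad br (t *\<^sub>R X) y \<bullet> b)" for t y
      using bounded_linear.sums[OF bounded_linear_inner_left exp_ad_sums[of "t *\<^sub>R X" y], of b]
      by (simp add: pow field_simps)
    have "((\<lambda>t. \<Sum>n. c n * t ^ n) has_real_derivative (\<Sum>n. diffs c n * t ^ n)) (at t)"
      using sums_summable[OF sums, of y] unfolding c_def[symmetric]
      by (intro termdiffs_strong_converges_everywhere)
    moreover have "(\<Sum>n. c n * t ^ n) = exp_ad br (t *\<^sub>R X) y \<bullet> b" for t
      using sums[of y t] by (simp add: c_def sums_iff)
    moreover have "diffs c n = (br X ^^ n) (br X y) \<bullet> b / fact n" for n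
      by (simp add: diffs_def c_def funpow_swap1 del: of_nat_Suc)
    then have "(\<Sum>n. diffs c n * t ^ n) = exp_ad br (t *\<^sub>R X) (br X y) \<bullet> b"
      using sums[of "br X y" t] by (simp add: sums_iff)
    ultimately show ?thesis by simp
  qed
  show ?thesis
    unfolding has_vector_derivative_def
  proof (subst has_derivative_componentwise_within, rule ballI)
    fix b :: 'a
    show "((\<lambda>t. exp_ad br (t *\<^sub>R X) y \<bullet> b) has_derivative (\<lambda>s. (s *\<^sub>R exp_ad br (t *\<^sub>R X) (br X y)) \<bullet> b)) (at t)"
      using comp[of b] by (simp add: has_field_derivative_def mult_commute_abs)
  qed
qed

lemma exp_ad_expand: "exp_ad br X y = (\<Sum>b\<in>Basis. (y \<bullet> b) *\<^sub>R exp_ad br X b)"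
proof -
  have "exp_ad br X y = exp_ad br X (\<Sum>b\<in>Basis. (y \<bullet> b) *\<^sub>R b)" by (simp add: euclidean_representation)
  then show ?thesis by (simp add: linear_sum[OF linear_exp_ad] linear_cmul[OF linear_exp_ad])
qed

text \<open>Expanding \<open>f u\<close> in the basis separates the two dependences on
  \<open>u\<close>, so the product rule for scalars times curves applies.\<close>

lemma exp_ad_has_derivative:
  assumes c: "(c has_derivative c') (at u within S)" and f: "(f has_derivative f') (at u within S)"
  shows "((\<lambda>u. exp_ad br (c u *\<^sub>R X) (f u)) has_derivative
      (\<lambda>v. c' v *\<^sub>R br X (exp_ad br (c u *\<^sub>R X) (f u)) + exp_ad br (c u *\<^sub>R X) (f' v))) (at u within S)"
proof -
  have e: "((\<lambda>u. exp_ad br (c u *\<^sub>R X) b) has_derivative (\<lambda>v. c' v *\<^sub>R exp_ad br (c u *\<^sub>R X) (br X b))) (at u within S)" for b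
    using has_derivative_compose[OF c exp_ad_has_vector_derivative[unfolded has_vector_derivative_def]] .
  have "((\<lambda>u. \<Sum>b\<in>Basis. (f u \<bullet> b) *\<^sub>R exp_ad br (c u *\<^sub>R X) b) has_derivative
      (\<lambda>v. \<Sum>b\<in>Basis. (f u \<bullet> b) *\<^sub>R (c' v *\<^sub>R exp_ad br (c u *\<^sub>R X) (br X b)) + (f' v \<bullet> b) *\<^sub>R exp_ad br (c u *\<^sub>R X) b))
      (at u within S)"
    by (intro has_derivative_sum has_derivative_scaleR has_derivative_inner_left f e)
  moreover have "(\<Sum>b\<in>Basis. (f u \<bullet> b) *\<^sub>R (r *\<^sub>R exp_ad br (c u *\<^sub>R X) (br X b)) + (w \<bullet> b) *\<^sub>R exp_ad br (c u *\<^sub>R X) b)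
      = r *\<^sub>R br X (exp_ad br (c u *\<^sub>R X) (f u)) + exp_ad br (c u *\<^sub>R X) w" for r w
  proof -
    have comm: "exp_ad br (t *\<^sub>R X) (br X y) = br X (exp_ad br (t *\<^sub>R X) y)" for t y
    proof (cases "t = 0")
      case False
      have "t *\<^sub>R exp_ad br (t *\<^sub>R X) (br X y) = t *\<^sub>R br X (exp_ad br (t *\<^sub>R X) y)"
        using exp_ad_br[of "t *\<^sub>R X" y] by (simp add: br_simps linear_cmul[OF linear_exp_ad])
      then show ?thesis using False by simp
    qed simp
    have "r *\<^sub>R br X (exp_ad br (c u *\<^sub>R X) (f u))
        = (\<Sum>b\<in>Basis. (f u \<bullet> b) *\<^sub>R (r *\<^sub>R exp_ad br (c u *\<^sub>R X) (br X b)))"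
      unfolding comm by (subst exp_ad_expand)
        (simp add: linear_sum[OF linear_right] br_simps scaleR_right.sum mult.commute)
    then show ?thesis
      using exp_ad_expand[of "c u *\<^sub>R X" w] by (simp add: sum.distrib)
  qed
  ultimately show ?thesis by (simp flip: exp_ad_expand)
qed

text \<open>Uniqueness for the equation f' = [X, f]: the curve exp (- t ad X) (f t) has derivative
  zero.\<close>

lemma exp_ad_uminus_curve:
  assumes "\<And>t::real. (f has_derivative (\<lambda>v. v *\<^sub>R br X (f t))) (at t)"
  shows "exp_ad br (- X) (f 1) = f 0"
proof -
  define F where "F t = exp_ad br ((- t) *\<^sub>R X) (f t)" for t :: real
  have "(F has_derivative (\<lambda>v. 0)) (at t)" for t
  proof -
    have "(F has_derivative (\<lambda>v. (- v) *\<^sub>R br X (exp_ad br ((- t) *\<^sub>R X) (f t))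
        + exp_ad br ((- t) *\<^sub>R X) (v *\<^sub>R br X (f t)))) (at t)"
      unfolding F_def by (intro exp_ad_has_derivative assms) (auto intro!: derivative_eq_intros)
    moreover have "v *\<^sub>R br X (exp_ad br ((- t) *\<^sub>R X) y) = exp_ad br ((- t) *\<^sub>R X) (v *\<^sub>R br X y)" for v y
    proof (cases "t = 0")
      case False
      have "(- t) *\<^sub>R br X (exp_ad br ((- t) *\<^sub>R X) y) = (- t) *\<^sub>R exp_ad br ((- t) *\<^sub>R X) (br X y)"
        using exp_ad_br[of "(- t) *\<^sub>R X" y] linear_cmul[OF linear_exp_ad, of "(- t) *\<^sub>R X" "- t" "br X y"]
        by (simp add: br_simps)
      then show ?thesis using False by (simp add: linear_cmul[OF linear_exp_ad])
    qed simp
    ultimately show ?thesis by simp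
  qed
  then obtain c where "\<And>t. F t = c"
    using has_derivative_zero_constant[OF convex_UNIV, of F] by auto
  then have "F 1 = F 0" by simp
  then show ?thesis by (simp add: F_def)
qed

lemma exp_ad_curve: "((\<lambda>t. exp_ad br (t *\<^sub>R X) y) has_derivative (\<lambda>v. v *\<^sub>R br X (exp_ad br (t *\<^sub>R X) y))) (at t)"
  using exp_ad_has_derivative[OF has_derivative_ident has_derivative_const, of X y t UNIV]
  by (simp add: linear_0[OF linear_exp_ad])

lemma exp_ad_uminus: "exp_ad br (- X) (exp_ad br X y) = y"
  using exp_ad_uminus_curve[OF exp_ad_curve, of X y] by simp

text \<open>By the Leibniz rule the bracket of the two transported elements solves f' = [X, f], so
  the uniqueness result determines it by its initial value.\<close>

lemma exp_ad_hom: "exp_ad br X (br a b) = br (exp_ad br X a) (exp_ad br X b)"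
proof -
  define f where "f t = br (exp_ad br (t *\<^sub>R X) a) (exp_ad br (t *\<^sub>R X) b)" for t :: real
  have "(f has_derivative (\<lambda>v. v *\<^sub>R br X (f t))) (at t)" for t
  proof -
    have "(f has_derivative (\<lambda>v. br (exp_ad br (t *\<^sub>R X) a) (v *\<^sub>R br X (exp_ad br (t *\<^sub>R X) b))
        + br (v *\<^sub>R br X (exp_ad br (t *\<^sub>R X) a)) (exp_ad br (t *\<^sub>R X) b))) (at t)"
      unfolding f_def by (rule bounded_bilinear.FDERIV[OF bounded_bilinear_br exp_ad_curve exp_ad_curve])
    moreover have "v *\<^sub>R br X (f t) = br (exp_ad br (t *\<^sub>R X) a) (v *\<^sub>R br X (exp_ad br (t *\<^sub>R X) b))
        + br (v *\<^sub>R br X (exp_ad br (t *\<^sub>R X) a)) (exp_ad br (t *\<^sub>R X) b)" for v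
      by (simp add: f_def leibniz[of X] br_simps scaleR_add_right)
    ultimately show ?thesis by simp
  qed
  then have "exp_ad br (- X) (f 1) = f 0" by (rule exp_ad_uminus_curve)
  then have "exp_ad br (- X) (br (exp_ad br X a) (exp_ad br X b)) = br a b" by (simp add: f_def)
  then show ?thesis using exp_ad_uminus[of "- X"] by (metis minus_minus)
qed

lemma adjoint_group_comp:
  assumes "g \<in> adjoint_group br" "h \<in> adjoint_group br"
  shows "g \<circ> h \<in> adjoint_group br"
  using assms(1)
proof (induction rule: adjoint_group.induct)
  case 1
  then show ?case using assms(2) by simp
next
  case (2 g X)
  then show ?case unfolding comp_assoc by (intro adjoint_group.intros(2))
qed

lemma exp_ad_in_adjoint_group: "exp_ad br X \<in> adjoint_group br"
  using adjoint_group.intros(2)[OF adjoint_group.intros(1), of br X] by (simp add: comp_def)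

lemma adjoint_group_linear: "g \<in> adjoint_group br \<Longrightarrow> linear g"
proof (induction rule: adjoint_group.induct)
  case (2 g X)
  then show ?case by (intro linear_compose[OF _ linear_exp_ad])
qed (simp add: id_def linear_ident)

lemma adjoint_group_hom: "g \<in> adjoint_group br \<Longrightarrow> g (br a b) = br (g a) (g b)"
  by (induction rule: adjoint_group.induct) (auto simp: exp_ad_hom)

lemma adjoint_group_bij: "g \<in> adjoint_group br \<Longrightarrow> bij g"
proof (induction rule: adjoint_group.induct)
  case (2 g X)
  have "bij (exp_ad br X)"
    using exp_ad_uminus[of X] exp_ad_uminus[of "- X"] by (intro o_bij[of "exp_ad br (- X)"]) auto
  then show ?case using 2 by (intro bij_comp)
qed (rule bij_id)

lemma adjoint_group_orbit:
  assumes "g \<in> adjoint_group br" "y \<in> adjoint_orbit br x"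
  shows "g y \<in> adjoint_orbit br x"
proof -
  obtain h where "h \<in> adjoint_group br" "y = h x" using assms(2) by (auto simp: adjoint_orbit_def)
  then show ?thesis
    using imageI[OF adjoint_group_comp[OF assms(1), of h], of "\<lambda>g. g x"] by (simp add: adjoint_orbit_def)
qed

text \<open>Elements of the adjoint group are automorphisms of the bracket and therefore carry
  tangent spaces isomorphically to tangent spaces.\<close>

lemma dim_orbit_tangent:
  assumes "y \<in> adjoint_orbit br x"
  shows "dim (orbit_tangent br y) = dim (orbit_tangent br x)"
proof -
  obtain g where g: "g \<in> adjoint_group br" "y = g x" using assms by (auto simp: adjoint_orbit_def)
  have "orbit_tangent br y = g ` orbit_tangent br x"
  proof -
    have "(\<lambda>X. br X (g x)) ` range g = range (\<lambda>X. br (g X) (g x))"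
      by (rule image_image)
    then show ?thesis
      using bij_is_surj[OF adjoint_group_bij[OF g(1)]]
      by (simp add: orbit_tangent_def g(2) image_image adjoint_group_hom[OF g(1)])
  qed
  then show ?thesis
    using dim_image_eq[OF adjoint_group_linear[OF g(1)]
        inj_on_subset[OF bij_is_inj[OF adjoint_group_bij[OF g(1)]] subset_UNIV]] by simp
qed

end

section \<open>Symplectic bases and positivity of the exterior power\<close>

text \<open>Gram matrix of a symplectic basis listed in consecutive pairs a0, b0, a1, b1, ...,
  matching the pairing of arguments in \<open>two_form_power\<close>.\<close>

definition std_symplectic :: "nat \<Rightarrow> nat \<Rightarrow> real" where
  "std_symplectic i j = (if even i \<and> j = Suc i then 1 else if even j \<and> i = Suc j then - 1 else 0)"

lemma std_symplectic_flip: "std_symplectic j i = - std_symplectic i j"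
  by (auto simp: std_symplectic_def)

text \<open>Only permutations of the pairs \<open>{2 i, 2 i + 1}\<close> contribute, and for these the sign counts
  the reversed pairs.\<close>

lemma std_symplectic_term_nonneg:
  assumes "\<sigma> permutes {..<2 * n}"
  shows "of_int (sign \<sigma>) * (\<Prod>i<n. std_symplectic (\<sigma> (2 * i)) (\<sigma> (2 * i + 1))) \<ge> 0"
  using assms
proof (induction n arbitrary: \<sigma>)
  case 0
  then have "\<sigma> = id" by (simp add: permutes_empty)
  then show ?case by simp
next
  case (Suc n)
  define T :: "(nat \<Rightarrow> nat) \<Rightarrow> real" where
    "T \<sigma> = of_int (sign \<sigma>) * (\<Prod>i<Suc n. std_symplectic (\<sigma> (2 * i)) (\<sigma> (2 * i + 1)))" for \<sigma>
  let ?S = "{..<2 * Suc n}"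
  have base: "T \<rho> \<ge> 0" if \<rho>: "\<rho> permutes ?S" "\<rho> (2 * n) = 2 * n" "\<rho> (2 * n + 1) = 2 * n + 1" for \<rho>
  proof -
    have "\<rho> permutes {..<2 * n}"
    proof (rule permutes_superset[OF \<rho>(1)])
      fix k assume "k \<in> ?S - {..<2 * n}"
      then have "k = 2 * n \<or> k = 2 * n + 1" by auto
      then show "\<rho> k = k" using \<rho> by auto
    qed
    then show ?thesis
      using Suc.IH[of \<rho>] \<rho>(2,3) by (simp add: T_def std_symplectic_def)
  qed
  have perm_sign: "sign (\<rho> \<circ> Transposition.transpose a b) = sign \<rho> * sign (Transposition.transpose a b)" if "\<rho> permutes ?S" for \<rho> a b
    using that permutation_permutes[of \<rho>] permutation_swap_id[of a b]
    by (intro sign_compose) auto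
  have trans: "\<rho> \<circ> Transposition.transpose a b permutes ?S" if "\<rho> permutes ?S" "a \<in> ?S" "b \<in> ?S" for \<rho> a b
    using that by (intro permutes_compose permutes_swap_id)
  have flip: "T \<rho> \<ge> 0" if \<rho>: "\<rho> permutes ?S" "{\<rho> (2 * n), \<rho> (2 * n + 1)} = {2 * n, 2 * n + 1}" for \<rho>
  proof (cases "\<rho> (2 * n) = 2 * n")
    case True
    then show ?thesis using \<rho>(2) by (intro base[OF \<rho>(1)]) (auto simp: doubleton_eq_iff)
  next
    case False
    then have sw: "\<rho> (2 * n) = 2 * n + 1" "\<rho> (2 * n + 1) = 2 * n"
      using \<rho>(2) by (auto simp: doubleton_eq_iff)
    define \<rho>' where "\<rho>' = \<rho> \<circ> Transposition.transpose (2 * n) (2 * n + 1)"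
    have "T \<rho>' \<ge> 0"
      using trans[OF \<rho>(1), of "2 * n" "2 * n + 1"] sw by (intro base) (auto simp: \<rho>'_def)
    moreover have "\<rho>' (2 * i) = \<rho> (2 * i)" "\<rho>' (2 * i + 1) = \<rho> (2 * i + 1)" if "i < n" for i
      using that by (auto simp: \<rho>'_def Transposition.transpose_def)
    moreover have "sign \<rho>' = - sign \<rho>"
      unfolding \<rho>'_def by (simp add: perm_sign[OF \<rho>(1)] sign_swap_id)
    moreover have "std_symplectic (\<rho>' (2 * n)) (\<rho>' (2 * n + 1)) = - std_symplectic (\<rho> (2 * n)) (\<rho> (2 * n + 1))"
      unfolding \<rho>'_def by (simp add: std_symplectic_flip[of "\<rho> (2 * n)"])
    ultimately show ?thesis by (simp add: T_def)
  qed
  show ?case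
  proof (cases "(\<Prod>i<Suc n. std_symplectic (\<sigma> (2 * i)) (\<sigma> (2 * i + 1))) = 0")
    case True
    then show ?thesis unfolding True by simp
  next
    case False
    \<comment> \<open>Some pair \<open>i\<close> of arguments receives the value
      \<open>2 * n\<close>; a nonzero factor forces its partner to be
      \<open>2 * n + 1\<close>.\<close>
    have "2 * n \<in> \<sigma> ` ?S" using permutes_image[OF Suc.prems] by auto
    then obtain k where k: "k < 2 * Suc n" "\<sigma> k = 2 * n" by auto
    define i where "i = k div 2"
    have i: "i \<le> n" "k = 2 * i \<or> k = 2 * i + 1" using k(1) by (auto simp: i_def)
    have "std_symplectic (\<sigma> (2 * i)) (\<sigma> (2 * i + 1)) \<noteq> 0"
      using False i(1) by (auto simp del: prod.lessThan_Suc)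
    then have pair: "{\<sigma> (2 * i), \<sigma> (2 * i + 1)} = {2 * n, 2 * n + 1}"
      using i(2) k(2) by (auto simp: std_symplectic_def split: if_splits)
    \<comment> \<open>Two transpositions exchange pair \<open>i\<close> with the last pair. They are
      both trivial or both odd, so the sign is kept, and the product is only reindexed.\<close>
    define \<sigma>1 where "\<sigma>1 = \<sigma> \<circ> Transposition.transpose (2 * i) (2 * n)"
    define \<sigma>2 where "\<sigma>2 = \<sigma>1 \<circ> Transposition.transpose (2 * i + 1) (2 * n + 1)"
    have \<sigma>1: "\<sigma>1 permutes ?S" unfolding \<sigma>1_def using i(1) by (intro trans[OF Suc.prems]) auto
    have \<sigma>2: "\<sigma>2 permutes ?S" unfolding \<sigma>2_def using i(1) by (intro trans[OF \<sigma>1]) auto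
    have s: "sign \<sigma>2 = sign \<sigma>"
      unfolding \<sigma>2_def perm_sign[OF \<sigma>1] unfolding \<sigma>1_def perm_sign[OF Suc.prems] by (simp add: sign_swap_id)
    have ev: "\<sigma>2 (2 * j) = \<sigma> (2 * Transposition.transpose i n j)" "\<sigma>2 (2 * j + 1) = \<sigma> (2 * Transposition.transpose i n j + 1)" for j
      unfolding \<sigma>2_def \<sigma>1_def Transposition.transpose_def by (auto, presburger+)
    have "Transposition.transpose i n permutes {..<Suc n}" using i(1) by (intro permutes_swap_id) auto
    then have "(\<Prod>j<Suc n. std_symplectic (\<sigma> (2 * j)) (\<sigma> (2 * j + 1)))
        = (\<Prod>j<Suc n. std_symplectic (\<sigma>2 (2 * j)) (\<sigma>2 (2 * j + 1)))"
      unfolding ev by (subst prod.permute) (auto simp: comp_def)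
    moreover have "T \<sigma>2 \<ge> 0"
      using pair unfolding ev[symmetric] by (intro flip[OF \<sigma>2]) (use ev[of n] pair in simp)
    ultimately show ?thesis unfolding T_def s by simp
  qed
qed

text \<open>The identity permutation contributes 1 to the sum, and no term is negative.\<close>

lemma two_form_power_pos:
  assumes "\<And>i j. i < 2 * n \<Longrightarrow> j < 2 * n \<Longrightarrow> \<omega> (v i) (v j) = std_symplectic i j"
  shows "two_form_power \<omega> n v > 0"
proof -
  let ?t = "\<lambda>\<sigma>. of_int (sign \<sigma>) * (\<Prod>i<n. \<omega> (v (\<sigma> (2 * i))) (v (\<sigma> (2 * i + 1)))) :: real"
  have t: "?t \<sigma> = of_int (sign \<sigma>) * (\<Prod>i<n. std_symplectic (\<sigma> (2 * i)) (\<sigma> (2 * i + 1)))"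
    if "\<sigma> permutes {..<2 * n}" for \<sigma>
  proof -
    have "\<sigma> k < 2 * n" if "k < 2 * n" for k
      using permutes_in_image[OF \<open>\<sigma> permutes {..<2 * n}\<close>, of k] that by simp
    then show ?thesis by (intro arg_cong2[where f = "(*)"] refl prod.cong assms) auto
  qed
  have id: "id permutes {..<2 * n}" by (rule permutes_id)
  have "?t id = 1"
    unfolding t[OF id] by (simp add: std_symplectic_def)
  moreover have "?t id \<le> (\<Sum>\<sigma> | \<sigma> permutes {..<2 * n}. ?t \<sigma>)"
  proof (rule member_le_sum)
    show "id \<in> {\<sigma>. \<sigma> permutes {..<2 * n}}" using id by simp
    show "finite {\<sigma>. \<sigma> permutes {..<2 * n}}" by (simp add: finite_permutations)
    fix \<sigma> assume "\<sigma> \<in> {\<sigma>. \<sigma> permutes {..<2 * n}} - {id}"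
    then have "\<sigma> permutes {..<2 * n}" by simp
    then show "?t \<sigma> \<ge> 0" using std_symplectic_term_nonneg[of \<sigma> n] t[of \<sigma>] by simp
  qed
  ultimately show ?thesis by (simp add: two_form_power_def)
qed

text \<open>Symplectic Gram-Schmidt: split off a hyperbolic plane and recurse on its complement. The
  form may be degenerate, and \<open>r\<close> collects the radical; in the application the radical
  is the centraliser of x.\<close>

lemma symplectic_basis_exists:
  fixes \<omega> :: "'a::euclidean_space \<Rightarrow> 'a \<Rightarrow> real"
  assumes bil: "bilinear \<omega>" and alt: "\<And>a. \<omega> a a = 0" and W: "subspace W"
  shows "\<exists>n v. (\<forall>i<2 * n. v i \<in> W) \<and> (\<forall>i<2 * n. \<forall>j<2 * n. \<omega> (v i) (v j) = std_symplectic i j)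
    \<and> (\<forall>w\<in>W. \<exists>c. \<exists>r\<in>W. (\<forall>u\<in>W. \<omega> r u = 0) \<and> w = r + (\<Sum>i<2 * n. c i *\<^sub>R v i))"
  using W
proof (induction "dim W" arbitrary: W rule: less_induct)
  case less
  note simps = bilinear_ladd[OF bil] bilinear_radd[OF bil] bilinear_lsub[OF bil]
    bilinear_rsub[OF bil] bilinear_lmul[OF bil] bilinear_rmul[OF bil] bilinear_lzero[OF bil] bilinear_rzero[OF bil]
  have skew: "\<omega> a b = - \<omega> b a" for a b
    using alt[of "a + b"] alt[of a] alt[of b] by (simp add: simps)
  show ?case
  proof (cases "\<forall>a\<in>W. \<forall>b\<in>W. \<omega> a b = 0")
    case True
    then show ?thesis by (intro exI[of _ 0]) auto
  next
    case False
    then obtain a b' where ab': "a \<in> W" "b' \<in> W" "\<omega> a b' \<noteq> 0" by auto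
    define b where "b = b' /\<^sub>R \<omega> a b'"
    have b: "b \<in> W" and ab: "\<omega> a b = 1" and ba: "\<omega> b a = - 1"
      using ab' less.prems skew[of b a] by (auto simp: b_def simps subspace_scale)
    define W' where "W' = {w \<in> W. \<omega> a w = 0 \<and> \<omega> b w = 0}"
    have W': "subspace W'"
      using less.prems by (auto simp: W'_def subspace_def simps)
    have "a \<notin> W'" using ba by (simp add: W'_def)
    then have "dim W' < dim W"
      using ab'(1) W' less.prems
      by (intro dim_psubset) (auto simp: W'_def span_eq_iff[THEN iffD2])
    then obtain n v where v: "\<And>i. i < 2 * n \<Longrightarrow> v i \<in> W'"
      "\<And>i j. i < 2 * n \<Longrightarrow> j < 2 * n \<Longrightarrow> \<omega> (v i) (v j) = std_symplectic i j"
      and dec: "\<And>w. w \<in> W' \<Longrightarrow> \<exists>c. \<exists>r\<in>W'. (\<forall>u\<in>W'. \<omega> r u = 0) \<and> w = r + (\<Sum>i<2 * n. c i *\<^sub>R v i)"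
      using less.hyps[OF _ W'] by blast
    \<comment> \<open>Projection onto the complement \<open>W'\<close> along the plane of
      \<open>a\<close> and \<open>b\<close>, read off from \<open>\<omega> a b = 1\<close>.\<close>
    define proj where "proj w = w - \<omega> w b *\<^sub>R a + \<omega> w a *\<^sub>R b" for w
    have proj: "proj w \<in> W'" if "w \<in> W" for w
      using that ab'(1) b less.prems skew[of a w] skew[of b w]
      by (auto simp: W'_def proj_def simps alt ab ba intro!: subspace_add subspace_diff subspace_scale)
    define v' where "v' = v(2 * n := a, 2 * n + 1 := b)"
    have v'_less: "v' i = v i" if "i < 2 * n" for i using that by (simp add: v'_def)
    have v'_last: "v' (2 * n) = a" "v' (Suc (2 * n)) = b" by (simp_all add: v'_def)
    have "v' i \<in> W" if i: "i < 2 * Suc n" for i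
    proof -
      have "i < 2 * n \<or> i = 2 * n \<or> i = Suc (2 * n)" using i by presburger
      then show ?thesis
        using v(1)[of i] ab'(1) b by (elim disjE) (simp_all add: v'_less v'_last W'_def)
    qed
    moreover have "\<omega> (v' i) (v' j) = std_symplectic i j" if ij: "i < 2 * Suc n" "j < 2 * Suc n" for i j
    proof -
      have old: "\<omega> a (v k) = 0" "\<omega> b (v k) = 0" "\<omega> (v k) a = 0" "\<omega> (v k) b = 0"
          "std_symplectic k (2 * n) = 0" "std_symplectic k (Suc (2 * n)) = 0"
          "std_symplectic (2 * n) k = 0" "std_symplectic (Suc (2 * n)) k = 0" if "k < 2 * n" for k
        using v(1)[OF that] that skew[of "v k" a] skew[of "v k" b]
        by ((auto simp: W'_def std_symplectic_def)[4],
            (simp add: std_symplectic_def, presburger?)+)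
      have new: "std_symplectic (2 * n) (2 * n) = 0" "std_symplectic (2 * n) (Suc (2 * n)) = 1"
          "std_symplectic (Suc (2 * n)) (2 * n) = - 1" "std_symplectic (Suc (2 * n)) (Suc (2 * n)) = 0"
        by (auto simp: std_symplectic_def)
      have "i < 2 * n \<or> i = 2 * n \<or> i = Suc (2 * n)" "j < 2 * n \<or> j = 2 * n \<or> j = Suc (2 * n)"
        using ij by presburger+
      then show ?thesis
        by (elim disjE) (simp_all add: v'_less v'_last old new v(2) alt ab ba)
    qed
    moreover have "\<exists>c. \<exists>r\<in>W. (\<forall>u\<in>W. \<omega> r u = 0) \<and> w = r + (\<Sum>i<2 * Suc n. c i *\<^sub>R v' i)" if w: "w \<in> W" for w
    proof -
      obtain c r where r: "r \<in> W'" "\<And>u. u \<in> W' \<Longrightarrow> \<omega> r u = 0" "proj w = r + (\<Sum>i<2 * n. c i *\<^sub>R v i)"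
        using dec[OF proj[OF w]] by blast
      have ra: "\<omega> r a = 0" "\<omega> r b = 0"
        using r(1) skew[of r a] skew[of r b] by (auto simp: W'_def)
      have "\<omega> r u = 0" if "u \<in> W" for u
      proof -
        have "u = proj u + \<omega> u b *\<^sub>R a - \<omega> u a *\<^sub>R b" by (simp add: proj_def)
        then have "\<omega> r u = \<omega> r (proj u + \<omega> u b *\<^sub>R a - \<omega> u a *\<^sub>R b)" by simp
        also have "\<dots> = 0" using r(2)[OF proj[OF that]] ra by (simp add: simps)
        finally show ?thesis .
      qed
      moreover define c' where "c' = c(2 * n := \<omega> w b, Suc (2 * n) := - \<omega> w a)"
      have "(\<Sum>i<2 * n. c' i *\<^sub>R v' i) = (\<Sum>i<2 * n. c i *\<^sub>R v i)"
        by (intro sum.cong) (auto simp: c'_def v'_less)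
      then have sum: "(\<Sum>i<2 * Suc n. c' i *\<^sub>R v' i) = (\<Sum>i<2 * n. c i *\<^sub>R v i) + \<omega> w b *\<^sub>R a - \<omega> w a *\<^sub>R b"
        by (simp add: v'_last) (simp add: c'_def)
      have "w = r + ((\<Sum>i<2 * n. c i *\<^sub>R v i) + \<omega> w b *\<^sub>R a - \<omega> w a *\<^sub>R b)"
        using r(3) by (simp add: proj_def algebra_simps)
      then have "w = r + (\<Sum>i<2 * Suc n. c' i *\<^sub>R v' i)"
        unfolding sum .
      moreover have "r \<in> W" using r(1) by (simp add: W'_def)
      ultimately show ?thesis by blast
    qed
    ultimately show ?thesis by blast
  qed
qed

section \<open>Charts of the orbit\<close>

context lie_alg
begin

text \<open>Coordinates of the second kind: a product of one-parameter groups applied to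
  \<open>x\<close>, the coordinate \<open>u \<bullet> b\<close> driving the direction
  \<open>X b\<close>. Each factor is differentiated only along its own line.\<close>

primrec chart :: "'a list \<Rightarrow> ('a \<Rightarrow> 'a) \<Rightarrow> 'a \<Rightarrow> 'a \<Rightarrow> 'a" where
  "chart [] X x u = x"
| "chart (b # bs) X x u = exp_ad br ((u \<bullet> b) *\<^sub>R X b) (chart bs X x u)"

text \<open>The derivative of \<open>chart bs X x\<close> at \<open>u\<close> in direction \<open>v\<close> is the value at \<open>chart bs X x u\<close> of the
  vector field of \<open>chart_field bs X u v\<close>.\<close>

primrec chart_field :: "'a list \<Rightarrow> ('a \<Rightarrow> 'a) \<Rightarrow> 'a \<Rightarrow> 'a \<Rightarrow> 'a" where
  "chart_field [] X u v = 0"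
| "chart_field (b # bs) X u v = (v \<bullet> b) *\<^sub>R X b + exp_ad br ((u \<bullet> b) *\<^sub>R X b) (chart_field bs X u v)"

lemma chart_in_orbit: "chart bs X x u \<in> adjoint_orbit br x"
proof (induction bs)
  case Nil
  then show ?case using imageI[OF adjoint_group.intros(1), of "\<lambda>g. g x"] by (simp add: adjoint_orbit_def)
next
  case (Cons b bs)
  then show ?case by (simp add: adjoint_group_orbit exp_ad_in_adjoint_group)
qed

text \<open>The outer factor is an automorphism, so it transports the field of the inner chart and
  adds its own direction.\<close>

lemma chart_has_derivative:
  "(chart bs X x has_derivative (\<lambda>v. br (chart_field bs X u v) (chart bs X x u))) (at u within S)"
proof (induction bs)
  case Nil
  have "chart [] X x = (\<lambda>u. x)" by (rule ext) simp
  then show ?case by simp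
next
  case (Cons b bs)
  have inner: "((\<lambda>u. u \<bullet> b) has_derivative (\<lambda>v. v \<bullet> b)) (at u within S)"
    by (intro has_derivative_inner_left has_derivative_ident)
  have "chart (b # bs) X x = (\<lambda>u. exp_ad br ((u \<bullet> b) *\<^sub>R X b) (chart bs X x u))"
    by (rule ext) simp
  then show ?case
    using exp_ad_has_derivative[OF inner Cons, of "X b"] by (simp add: br_simps exp_ad_hom)
qed

lemma continuous_on_exp_ad:
  assumes "continuous_on S c" "continuous_on S f"
  shows "continuous_on S (\<lambda>u. exp_ad br (c u *\<^sub>R X) (f u))"
proof -
  have "isCont (\<lambda>t. exp_ad br (t *\<^sub>R X) b) t" for t b
    by (rule has_vector_derivative_continuous[OF exp_ad_has_vector_derivative])
  then have "continuous_on S (\<lambda>u. exp_ad br (c u *\<^sub>R X) b)" for b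
    by (intro continuous_on_compose2[OF _ assms(1), of UNIV "\<lambda>t. exp_ad br (t *\<^sub>R X) b"] continuous_at_imp_continuous_on) auto
  then show ?thesis
    by (subst exp_ad_expand) (intro continuous_intros assms)
qed

lemma continuous_on_chart: "continuous_on S (chart bs X x)"
  by (intro has_derivative_continuous_on[OF chart_has_derivative])

lemma continuous_on_chart_field: "continuous_on S (\<lambda>u. chart_field bs X u v)"
proof (induction bs)
  case (Cons b bs)
  then show ?case by (auto intro!: continuous_intros continuous_on_exp_ad)
qed simp

lemma linear_chart_field: "linear (chart_field bs X u)"
proof (rule linearI)
  show "chart_field bs X u (v + w) = chart_field bs X u v + chart_field bs X u w" for v w
    by (induction bs) (simp_all add: linear_add[OF linear_exp_ad] inner_add_left scaleR_add_left)
  show "chart_field bs X u (c *\<^sub>R v) = c *\<^sub>R chart_field bs X u v" for c v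
    by (induction bs) (simp_all add: linear_cmul[OF linear_exp_ad] scaleR_add_right)
qed

lemma chart_field_eq_0: "(\<And>b. b \<in> set bs \<Longrightarrow> v \<bullet> b = 0) \<Longrightarrow> chart_field bs X u v = 0"
  by (induction bs) (simp_all add: linear_0[OF linear_exp_ad])

lemma chart_field_expand:
  assumes "set bs \<subseteq> Basis"
  shows "chart_field bs X u v = (\<Sum>b\<in>set bs. (v \<bullet> b) *\<^sub>R chart_field bs X u b)"
proof -
  define p where "p = (\<Sum>b\<in>set bs. (v \<bullet> b) *\<^sub>R b)"
  have "p \<bullet> b = v \<bullet> b" if "b \<in> set bs" for b
  proof -
    have "p \<bullet> b = (\<Sum>c\<in>set bs. (v \<bullet> c) * (if c = b then 1 else 0))"
      unfolding p_def inner_sum_left using assms that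
      by (intro sum.cong) (auto simp: inner_Basis subset_iff)
    then show ?thesis using that by (simp add: if_distrib cong: if_cong)
  qed
  then have "chart_field bs X u (v - p) = 0"
    by (intro chart_field_eq_0) (simp add: inner_diff_left)
  then have "chart_field bs X u v = chart_field bs X u p"
    by (simp add: linear_diff[OF linear_chart_field])
  then show ?thesis
    by (simp add: p_def linear_sum[OF linear_chart_field] linear_cmul[OF linear_chart_field])
qed

lemma chart_0: "chart bs X x 0 = x"
  by (induction bs) simp_all

lemma chart_field_0: "distinct bs \<Longrightarrow> set bs \<subseteq> Basis \<Longrightarrow> b \<in> set bs \<Longrightarrow> chart_field bs X 0 b = X b"
proof (induction bs)
  case (Cons a bs)
  show ?case
  proof (cases "a = b")
    case True
    have "chart_field bs X 0 b = 0"
      using Cons.prems True by (intro chart_field_eq_0) (auto simp: inner_Basis)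
    then show ?thesis using Cons.prems True by (simp add: inner_Basis)
  next
    case False
    then show ?thesis using Cons by (auto simp: inner_Basis)
  qed
qed simp

lemma bounded_bilinear_killing: "bounded_bilinear (killing br)"
  using killing_linear_right killing_linear_left
  by (simp add: bilinear_conv_bounded_bilinear[symmetric] bilinear_def)

text \<open>Naming the fields eliminates the \<open>THE\<close> in \<open>kks_form\<close>. The
  result is visibly continuous, and homogeneous of degree \<open>n\<close> in the first argument of
  the Killing form.\<close>

lemma liouville_form_fields:
  assumes "dim (orbit_tangent br y) = 2 * n"
  shows "liouville_form br y (\<lambda>i. br (Z (bs ! i)) y)
    = two_form_power (\<lambda>a b. killing br y (br (Z a) (Z b))) n ((!) bs)"
  unfolding liouville_form_def two_form_power_def assms by (simp add: kks_form_eq[OF lie])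

end

context semisimple_lie_alg
begin

text \<open>Since \<kappa>([X, x], Y) = - \<omega>(X, Y), the radical of \<omega> is the centraliser
  of x. The map X to [X, x] therefore sends a symplectic basis modulo the radical to a basis of the
  tangent space.\<close>

lemma orbit_tangent_symplectic_basis:
  obtains n v where "dim (orbit_tangent br x) = 2 * n"
    "\<And>i j. i < 2 * n \<Longrightarrow> j < 2 * n \<Longrightarrow> killing br x (br (v i) (v j)) = std_symplectic i j"
    "\<And>c. (\<Sum>i<2 * n. c i *\<^sub>R br (v i) x) = 0 \<Longrightarrow> (\<forall>i<2 * n. c i = 0)"
proof -
  define \<omega> where "\<omega> X Y = killing br x (br X Y)" for X Y
  have "bilinear \<omega>"
    unfolding bilinear_def \<omega>_def by (auto intro!: linearI simp: br_simps killing_simps)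
  moreover have "\<omega> a a = 0" for a by (simp add: \<omega>_def killing_simps)
  ultimately obtain n v where v: "\<And>i j. i < 2 * n \<Longrightarrow> j < 2 * n \<Longrightarrow> \<omega> (v i) (v j) = std_symplectic i j"
    and dec: "\<And>w. \<exists>c r. (\<forall>u. \<omega> r u = 0) \<and> w = r + (\<Sum>i<2 * n. c i *\<^sub>R v i)"
    using symplectic_basis_exists[of \<omega> UNIV] by simp blast
  have pair: "killing br (br X x) Y = - \<omega> X Y" for X Y
    using killing_br[of x X Y] antisym[of X x] by (simp add: \<omega>_def killing_simps)
  define w where "w i = br (v i) x" for i
  have indep: "\<forall>i<2 * n. c i = 0" if c: "(\<Sum>i<2 * n. c i *\<^sub>R w i) = 0" for c
  proof (intro allI impI)
    fix k assume k: "k < 2 * n"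
    \<comment> \<open>\<open>j\<close> is the partner of \<open>k\<close>: in column
      \<open>j\<close> of the Gram matrix only row \<open>k\<close> is nonzero, so pairing with
      \<open>v j\<close> isolates \<open>c k\<close>.\<close>
    define j where "j = (if even k then Suc k else k - 1)"
    have "j < 2 * n" using k unfolding j_def by presburger
    moreover have "std_symplectic k j \<noteq> 0"
      by (cases "even k") (auto simp: j_def std_symplectic_def elim: oddE)
    moreover have "std_symplectic i j = 0" if "i \<noteq> k" for i
      using that unfolding j_def std_symplectic_def by (auto; presburger)
    ultimately have j: "j < 2 * n" "std_symplectic k j \<noteq> 0" "\<And>i. i \<noteq> k \<Longrightarrow> std_symplectic i j = 0"
      by blast+
    have "0 = - killing br (\<Sum>i<2 * n. c i *\<^sub>R w i) (v j)"
      using c by (simp add: killing_simps)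
    also have "\<dots> = (\<Sum>i<2 * n. c i * std_symplectic i j)"
      using j(1) by (simp add: linear_sum[OF killing_linear_left] killing_simps w_def pair v sum_negf)
    also have "\<dots> = (\<Sum>i<2 * n. if i = k then c k * std_symplectic k j else 0)"
      using j(3) by (intro sum.cong) auto
    also have "\<dots> = c k * std_symplectic k j" using k by simp
    finally show "c k = 0" using j(2) by simp
  qed
  have inj: "inj_on w {..<2 * n}"
  proof (rule inj_onI, rule ccontr)
    fix i j assume ij: "i \<in> {..<2 * n}" "j \<in> {..<2 * n}" "w i = w j" "i \<noteq> j"
    have "(\<Sum>k<2 * n. (if k = i then 1 else if k = j then - 1 else 0) *\<^sub>R w k)
        = (\<Sum>k<2 * n. (if k = i then w i else 0) - (if k = j then w j else 0))"
      using ij(4) by (intro sum.cong) auto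
    also have "\<dots> = 0" using ij by (simp add: sum_subtractf)
    finally show False using indep[of "\<lambda>k. if k = i then 1 else if k = j then - 1 else 0"] ij by auto
  qed
  have "independent (w ` {..<2 * n})"
    using indep[of "\<lambda>i. u (w i)" for u] inj
    by (auto simp: independent_explicit_finite_subsets dependent_finite sum.reindex)
  moreover have "orbit_tangent br x = span (w ` {..<2 * n})"
  proof (intro equalityI)
    show "orbit_tangent br x \<subseteq> span (w ` {..<2 * n})"
    proof
      fix t assume "t \<in> orbit_tangent br x"
      then obtain X where X: "t = br X x" by (auto simp: orbit_tangent_def)
      obtain c r where cr: "\<And>u. \<omega> r u = 0" "X = r + (\<Sum>i<2 * n. c i *\<^sub>R v i)" using dec by blast
      have "br r x = 0" using pair[of r] cr(1) by (intro killing_nondegenerate) simp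
      then have "t = (\<Sum>i<2 * n. c i *\<^sub>R w i)"
        by (simp add: X cr(2) br_simps w_def linear_sum[OF linear_left])
      then show "t \<in> span (w ` {..<2 * n})"
        by (simp only:) (intro span_sum span_scale span_base imageI)
    qed
    show "span (w ` {..<2 * n}) \<subseteq> orbit_tangent br x"
      unfolding orbit_tangent_def
      by (intro span_minimal linear_subspace_image linear_left subspace_UNIV) (auto simp: w_def)
  qed
  ultimately have "dim (orbit_tangent br x) = 2 * n"
    using inj by (simp add: dim_eq_card_independent card_image)
  then show ?thesis using that[of n v] v indep by (simp add: \<omega>_def w_def)
qed

text \<open>The directions form a symplectic basis at x, so at 0 the derivative is injective and the
  density positive. Both persist on a small ball. The derivative is returned through fields
  \<open>Z\<close> because the density depends on them.\<close>

lemma orbit_param_exists: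
  obtains bs U \<phi> Z n where "orbit_param br x bs U \<phi> (\<lambda>u v. br (Z u v) (\<phi> u))" "0 \<in> U"
    "dim (orbit_tangent br x) = 2 * n" "\<And>b. continuous_on U (\<lambda>u. Z u b)" "continuous_on U \<phi>"
    "\<And>u. u \<in> U \<Longrightarrow> two_form_power (\<lambda>a b. killing br (\<phi> u) (br (Z u a) (Z u b))) n ((!) bs) > 0"
proof -
  obtain n v where n: "dim (orbit_tangent br x) = 2 * n"
    and v: "\<And>i j. i < 2 * n \<Longrightarrow> j < 2 * n \<Longrightarrow> killing br x (br (v i) (v j)) = std_symplectic i j"
    and indep: "\<And>c. (\<Sum>i<2 * n. c i *\<^sub>R br (v i) x) = 0 \<Longrightarrow> (\<forall>i<2 * n. c i = 0)"
    by (rule orbit_tangent_symplectic_basis) blast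
  obtain xs :: "'a list" where xs: "set xs = Basis" "distinct xs"
    using finite_distinct_list[OF finite_Basis] by blast
  define bs where "bs = take (2 * n) xs"
  have "2 * n \<le> length xs"
    using dim_subset_UNIV[of "orbit_tangent br x"] distinct_card[OF xs(2)] n xs(1) by simp
  then have bs: "length bs = 2 * n" "distinct bs" "set bs \<subseteq> Basis"
    using xs set_take_subset[of "2 * n" xs] by (auto simp: bs_def)
  define X where "X b = v (THE i. i < 2 * n \<and> bs ! i = b)" for b
  have X: "X (bs ! i) = v i" if "i < 2 * n" for i
  proof -
    have "(THE j. j < 2 * n \<and> bs ! j = bs ! i) = i"
      using that bs(1,2) by (intro the_equality) (auto simp: nth_eq_iff_index_eq)
    then show ?thesis by (simp add: X_def)
  qed
  define \<phi> where "\<phi> = chart bs X x"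
  define Z where "Z = chart_field bs X"
  define D where "D u v = br (Z u v) (\<phi> u)" for u v
  define S where "S = span (set bs)"
  have Z_cont: "continuous_on V (\<lambda>u. Z u b)" for V b
    unfolding Z_def by (rule continuous_on_chart_field)
  have \<phi>_cont: "continuous_on V \<phi>" for V
    unfolding \<phi>_def by (rule continuous_on_chart)
  have D_cont: "continuous_on V (\<lambda>u. D u b)" for V b
    unfolding D_def by (intro bounded_bilinear.continuous_on[OF bounded_bilinear_br] Z_cont \<phi>_cont)
  have D_deriv: "(\<phi> has_derivative D u) (at u within V)" for u V
    unfolding D_def Z_def \<phi>_def by (rule chart_has_derivative)
  have D_lin: "linear (D u)" for u
    using D_deriv[of u UNIV] by (rule has_derivative_linear)
  have D_expand: "D u v = (\<Sum>b\<in>set bs. (v \<bullet> b) *\<^sub>R D u b)" for u v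
    unfolding D_def Z_def
    by (subst chart_field_expand[OF bs(3)]) (simp add: linear_sum[OF linear_left] br_simps)
  have Z_0: "Z 0 (bs ! i) = v i" if "i < 2 * n" for i
    unfolding Z_def using that bs X by (subst chart_field_0) auto
  have \<phi>_0: "\<phi> 0 = x" by (simp add: \<phi>_def chart_0)
  have dimS: "dim S = 2 * n"
    unfolding S_def using bs independent_mono[OF independent_Basis bs(3)]
    by (simp add: dim_eq_card_independent distinct_card)
  have D_0: "t = 0" if t: "t \<in> S" "D 0 t = 0" for t
  proof -
    have "(\<Sum>i<2 * n. (t \<bullet> bs ! i) *\<^sub>R br (v i) x) = (\<Sum>i<2 * n. (t \<bullet> bs ! i) *\<^sub>R D 0 (bs ! i))"
      by (intro sum.cong) (auto simp: D_def Z_0 \<phi>_0)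
    also have "\<dots> = D 0 t"
    proof -
      have "set bs = (!) bs ` {..<2 * n}" using bs(1) by (auto simp: set_conv_nth)
      moreover have "inj_on ((!) bs) {..<2 * n}" using bs(1,2) by (auto simp: inj_on_def nth_eq_iff_index_eq)
      ultimately show ?thesis by (subst D_expand) (simp add: sum.reindex)
    qed
    finally have "t \<bullet> bs ! i = 0" if "i < 2 * n" for i 
      using indep[of "\<lambda>i. t \<bullet> bs ! i"] t(2) that by simp
    then have "orthogonal t b" if "b \<in> set bs" for b
      using that bs(1) by (auto simp: orthogonal_def in_set_conv_nth)
    then have "orthogonal t t"
      using t(1) orthogonal_to_span unfolding S_def by blast
    then show ?thesis by (simp add: orthogonal_self)
  qed
  obtain B where B: "B > 0" "\<And>t. t \<in> S \<Longrightarrow> B * norm t \<le> norm (D 0 t)"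
    using injective_imp_isometric[of S "D 0"] D_0 D_lin[of 0]
    by (auto simp: S_def closed_subspace linear_conv_bounded_linear)
  \<comment> \<open>\<open>E\<close> bounds the distance of \<open>D u\<close> from
    \<open>D 0\<close>; \<open>F\<close> is the density.\<close>
  define E where "E u = (\<Sum>b\<in>set bs. norm (D u b - D 0 b))" for u
  define F where "F u = two_form_power (\<lambda>a b. killing br (\<phi> u) (br (Z u a) (Z u b))) n ((!) bs)" for u
  have "continuous_on UNIV E"
    unfolding E_def by (intro continuous_intros D_cont)
  have "continuous_on UNIV F"
    unfolding F_def two_form_power_def
    by (intro continuous_intros bounded_bilinear.continuous_on[OF bounded_bilinear_killing]
        bounded_bilinear.continuous_on[OF bounded_bilinear_br] Z_cont \<phi>_cont) simp
  \<comment> \<open>\<open>D 0\<close> expands norms on \<open>S\<close> by at least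
    \<open>B\<close>. A deviation of at most \<open>B / 2\<close> keeps \<open>D u\<close> injective
    there and, by the mean value inequality for \<open>\<phi> - D 0\<close>, makes
    \<open>\<phi>\<close> injective.\<close>
  have "E 0 < B / 2" using B(1) by (simp add: E_def)
  moreover have "F 0 > 0"
    unfolding F_def by (intro two_form_power_pos) (simp add: Z_0 \<phi>_0 v)
  ultimately have "0 \<in> {u. E u < B / 2} \<inter> {u. F u > 0}" by simp
  moreover have "open ({u. E u < B / 2} \<inter> {u. F u > 0})"
    using \<open>continuous_on UNIV E\<close> \<open>continuous_on UNIV F\<close>
    by (intro open_Int open_Collect_less continuous_intros)
  ultimately obtain d where d: "d > 0" "ball 0 d \<subseteq> {u. E u < B / 2} \<inter> {u. F u > 0}"
    using openE by blast
  define U where "U = S \<inter> ball 0 d"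
  have U: "E u < B / 2" "F u > 0" "u \<in> S" if "u \<in> U" for u
    using that d(2) by (auto simp: U_def)
  have close: "norm (D u t - D 0 t) \<le> B / 2 * norm t" if "u \<in> U" for u t
  proof -
    have "D u t - D 0 t = (\<Sum>b\<in>set bs. (t \<bullet> b) *\<^sub>R (D u b - D 0 b))"
      by (subst (1 2) D_expand) (simp add: sum_subtractf scaleR_diff_right)
    then have "norm (D u t - D 0 t) \<le> (\<Sum>b\<in>set bs. \<bar>t \<bullet> b\<bar> * norm (D u b - D 0 b))"
      by (simp add: sum_norm_le)
    also have "\<dots> \<le> (\<Sum>b\<in>set bs. norm t * norm (D u b - D 0 b))"
      using bs(3) Basis_le_norm by (intro sum_mono mult_right_mono) auto
    also have "\<dots> = norm t * E u" by (simp add: E_def sum_distrib_left)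
    also have "\<dots> \<le> norm t * (B / 2)" using U(1)[OF that] by (intro mult_left_mono) auto
    finally show ?thesis by (simp add: mult.commute)
  qed
  have "inj_on \<phi> U"
  proof (rule inj_onI)
    fix s t assume st: "s \<in> U" "t \<in> U" "\<phi> s = \<phi> t"
    have "norm ((\<phi> s - D 0 s) - (\<phi> t - D 0 t)) \<le> B / 2 * norm (s - t)"
    proof (rule differentiable_bound[of U])
      show "convex U" unfolding U_def S_def by (intro convex_Int subspace_imp_convex subspace_span convex_ball)
      show "((\<lambda>u. \<phi> u - D 0 u) has_derivative (\<lambda>t. D u t - D 0 t)) (at u within U)" for u
        by (intro has_derivative_diff D_deriv linear_imp_has_derivative D_lin)
      show "onorm (\<lambda>t. D u t - D 0 t) \<le> B / 2" if "u \<in> U" for u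
        using close[OF that] B(1) by (intro onorm_bound) auto
    qed (use st in auto)
    then have "norm (D 0 (s - t)) \<le> B / 2 * norm (s - t)"
      using st(3) by (simp add: linear_diff[OF D_lin] norm_minus_commute)
    moreover have "B * norm (s - t) \<le> norm (D 0 (s - t))"
      using U(3) st(1,2) by (intro B(2)) (simp add: S_def span_diff)
    ultimately have "B * norm (s - t) \<le> 0" by simp
    then show "s = t" using B(1) by (simp add: mult_le_0_iff)
  qed
  moreover have "D u ` S = orbit_tangent br (\<phi> u)" if "u \<in> U" for u
  proof -
    have orb: "\<phi> u \<in> adjoint_orbit br x" unfolding \<phi>_def by (rule chart_in_orbit)
    have inj: "inj_on (D u) S"
    proof (rule inj_onI)
      fix s t assume st: "s \<in> S" "t \<in> S" "D u s = D u t"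
      have "B * norm (s - t) \<le> norm (D 0 (s - t))"
        using st(1,2) by (intro B(2)) (simp add: S_def span_diff)
      moreover have "norm (D 0 (s - t)) \<le> B / 2 * norm (s - t)"
        using close[OF that, of "s - t"] st(3) norm_minus_commute[of "D 0 s"]
        by (simp add: linear_diff[OF D_lin])
      ultimately have "B * norm (s - t) \<le> 0" by simp
      then show "s = t" using B(1) by (simp add: mult_le_0_iff)
    qed
    have "dim (D u ` S) = 2 * n"
      using dim_image_eq[OF D_lin[of u], of S] inj dimS by (simp add: S_def span_span)
    moreover have "D u ` S \<subseteq> orbit_tangent br (\<phi> u)"
      by (auto simp: D_def orbit_tangent_def)
    moreover have "subspace (orbit_tangent br (\<phi> u))"
      unfolding orbit_tangent_def by (intro linear_subspace_image linear_left subspace_UNIV)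
    moreover have "subspace (D u ` S)"
      unfolding S_def by (intro linear_subspace_image D_lin subspace_span)
    ultimately show ?thesis
      using dim_orbit_tangent[OF orb] n by (intro subspace_dim_equal) auto
  qed
  moreover have "openin (top_of_set S) U"
    unfolding U_def by (intro openin_open_Int open_ball)
  moreover have "\<phi> ` U \<subseteq> adjoint_orbit br x"
    using chart_in_orbit by (auto simp: \<phi>_def)
  ultimately have "orbit_param br x bs U \<phi> D"
    unfolding orbit_param_def using bs n D_deriv D_cont by (simp add: S_def)
  moreover have "D = (\<lambda>u v. br (Z u v) (\<phi> u))" by (intro ext) (simp add: D_def)
  moreover have "0 \<in> U" using d(1) by (simp add: U_def S_def span_zero)
  ultimately show ?thesis
    using that[of bs U \<phi> Z n] n Z_cont \<phi>_cont U(2) by (simp add: F_def)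
qed

end

section \<open>Lower bounds for the Liouville measure\<close>

lemma emeasure_lborel_span_pos:
  fixes bs :: "'a::euclidean_space list"
  assumes U: "openin (top_of_set (span (set bs))) U" and "0 \<in> U"
  shows "emeasure (lborel_span bs) U > 0"
proof -
  interpret product_sigma_finite "\<lambda>_::'a. lborel :: real measure" by unfold_locales
  let ?P = "\<Pi>\<^sub>M b\<in>set bs. (lborel :: real measure)"
  let ?f = "\<lambda>c. \<Sum>b\<in>set bs. c b *\<^sub>R b"
  obtain e where e: "e > 0" "\<And>u. u \<in> span (set bs) \<Longrightarrow> norm u < e \<Longrightarrow> u \<in> U"
    using U \<open>0 \<in> U\<close> unfolding openin_euclidean_subtopology_iff by (auto simp: dist_norm)
  \<comment> \<open>The summand 1 keeps \<open>s\<close> positive for empty \<open>bs\<close> and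
    makes the later inequality strict: the cube of half-side \<open>d\<close> maps into the ball of
    radius \<open>e\<close>.\<close>
  define s where "s = (\<Sum>b\<in>set bs. norm b) + 1"
  have s: "s > 0" unfolding s_def by (intro add_nonneg_pos sum_nonneg) auto
  define d where "d = e / s"
  have d: "d > 0" using e(1) s by (simp add: d_def)
  have f_meas: "?f \<in> measurable ?P (restrict_space borel (span (set bs)))"
  proof (rule measurable_restrict_space2)
    show "?f \<in> space ?P \<rightarrow> span (set bs)"
      by (intro funcsetI span_sum span_scale span_base)
    show "?f \<in> borel_measurable ?P"
      by measurable
  qed
  have U_sets: "U \<in> sets (restrict_space borel (span (set bs)))"
    using U by (auto simp: openin_open sets_restrict_space)
  have "0 < (\<Prod>b\<in>set bs. emeasure lborel {- d<..<d})"
    using d by (simp add: prod_constant ennreal_power)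
  also have "\<dots> = emeasure ?P (\<Pi>\<^sub>E b\<in>set bs. {- d<..<d})"
    by (subst emeasure_PiM) auto
  also have "\<dots> \<le> emeasure ?P (?f -` U \<inter> space ?P)"
  proof (rule emeasure_mono)
    show "(\<Pi>\<^sub>E b\<in>set bs. {- d<..<d}) \<subseteq> ?f -` U \<inter> space ?P"
    proof
      fix c assume c: "c \<in> (\<Pi>\<^sub>E b\<in>set bs. {- d<..<d})"
      have "norm (?f c) \<le> (\<Sum>b\<in>set bs. d * norm b)"
        using c by (intro sum_norm_le) (force intro!: mult_right_mono simp: PiE_iff abs_le_iff)
      also have "\<dots> = d * (s - 1)" by (simp add: s_def sum_distrib_left)
      also have "\<dots> < d * s" using d by simp
      also have "\<dots> = e" using s by (simp add: d_def)
      finally have "?f c \<in> U"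
        by (intro e(2) span_sum span_scale span_base)
      then show "c \<in> ?f -` U \<inter> space ?P"
        using c by (auto simp: space_PiM PiE_iff)
    qed
    show "?f -` U \<inter> space ?P \<in> sets ?P"
      using f_meas U_sets by (rule measurable_sets)
  qed
  also have "\<dots> = emeasure (lborel_span bs) U"
    unfolding lborel_span_def using f_meas U_sets by (rule emeasure_distr[symmetric])
  finally show ?thesis .
qed

lemma borel_measurable_lborel_span:
  fixes f :: "'a::euclidean_space \<Rightarrow> 'b::topological_space"
  assumes "continuous_on U f" "U \<subseteq> span (set bs)"
  shows "f \<in> borel_measurable (restrict_space (lborel_span bs) U)"
proof -
  have "U \<inter> (span (set bs) \<inter> A) = U \<inter> A" for A
    using assms(2) by auto
  then have "sets (restrict_space (lborel_span bs) U) = sets (restrict_space borel U)"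
    by (simp add: lborel_span_def sets_restrict_space image_image)
  then show ?thesis
    using borel_measurable_continuous_on_restrict[OF assms(1)] by (simp cong: measurable_cong_sets)
qed

text \<open>The supremum dominates each chart measure, whose integral unfolds through
  \<open>distr\<close> and \<open>density\<close>. The continuous \<open>F\<close> supplies
  measurability of the density.\<close>

lemma liouville_measure_ge:
  assumes par: "orbit_param br x bs U \<phi> D" and cont: "continuous_on U \<phi>"
    and dens: "\<And>u. u \<in> U \<Longrightarrow> liouville_form br (\<phi> u) (\<lambda>i. D u (bs ! i)) = F u" "continuous_on U F"
    and f: "f \<in> borel_measurable borel"
  shows "(\<integral>\<^sup>+ y. f y \<partial>(liouville_measure br x)) \<ge>
    (\<integral>\<^sup>+ u. ennreal \<bar>F u\<bar> * f (\<phi> u) \<partial>(restrict_space (lborel_span bs) U))"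
proof -
  let ?R = "restrict_space borel (adjoint_orbit br x)"
  let ?M = "restrict_space (lborel_span bs) U"
  let ?G = "\<lambda>u. ennreal \<bar>liouville_form br (\<phi> u) (\<lambda>i. D u (bs ! i))\<bar>"
  let ?A = "{param_measure br x bs U \<phi> D | bs U \<phi> D. orbit_param br x bs U \<phi> D}"
  have U: "U \<subseteq> span (set bs)" "\<phi> ` U \<subseteq> adjoint_orbit br x"
    using par openin_imp_subset by (fastforce simp: orbit_param_def)+
  have space_M: "space ?M = U"
    using U(1) by (auto simp: space_restrict_space lborel_span_def)
  have mem: "param_measure br x bs U \<phi> D \<in> ?A" using par by blast
  have sets_A: "sets m = sets ?R" "space m = space ?R" if "m \<in> ?A" for m
    using that by (auto simp: param_measure_def)
  \<comment> \<open>All chart measures share one sigma-algebra, so the supremum has it too; only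
    then can the integrals be compared.\<close>
  have "sets (Sup ?A) = sigma_sets (space ?R) (\<Union>m\<in>?A. sets m)"
    using sets_A(2) mem by (intro sets_Sup_eq) auto
  also have "(\<Union>m\<in>?A. sets m) = sets ?R"
    using sets_A(1) mem by (metis (no_types, lifting) SUP_eq_const empty_iff)
  finally have sets_Sup: "sets (Sup ?A) = sets ?R"
    by (simp only: sets.sigma_sets_eq)
  have \<phi>_meas: "\<phi> \<in> measurable ?M ?R"
    using U(2) by (intro measurable_restrict_space2 borel_measurable_lborel_span cont U(1)) (auto simp: space_M)
  have "(\<lambda>u. ennreal \<bar>F u\<bar>) \<in> borel_measurable ?M"
    using borel_measurable_lborel_span[OF dens(2) U(1)] by measurable
  then have G_meas: "?G \<in> borel_measurable ?M"
    by (subst measurable_cong[where g = "\<lambda>u. ennreal \<bar>F u\<bar>"]) (simp_all add: space_M dens(1))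
  have f_R: "f \<in> borel_measurable ?R"
    using f by (rule measurable_restrict_space1)
  have f_meas: "(\<lambda>u. f (\<phi> u)) \<in> borel_measurable ?M"
    by (rule measurable_compose[OF \<phi>_meas f_R])
  have "(\<integral>\<^sup>+ u. ennreal \<bar>F u\<bar> * f (\<phi> u) \<partial>?M) = (\<integral>\<^sup>+ u. ?G u * f (\<phi> u) \<partial>?M)"
    by (intro nn_integral_cong) (simp add: space_M dens(1))
  also have "\<dots> = (\<integral>\<^sup>+ u. f (\<phi> u) \<partial>density ?M ?G)"
    by (rule nn_integral_density[symmetric, OF G_meas f_meas])
  also have "\<dots> = (\<integral>\<^sup>+ y. f y \<partial>param_measure br x bs U \<phi> D)"
    unfolding param_measure_def using \<phi>_meas f_R by (intro nn_integral_distr[symmetric]) simp_all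
  also have "\<dots> \<le> (\<integral>\<^sup>+ y. f y \<partial>Sup ?A)"
    using sets_Sup sets_A(1)[OF mem] mem by (intro nn_integral_mono_measure Sup_upper) simp_all
  finally show ?thesis by (simp add: liouville_measure_def)
qed

section \<open>Scaling and divergence of the integral\<close>

lemma (in lie_alg) orbit_tangent_scale:
  assumes "s \<noteq> 0"
  shows "orbit_tangent br (s *\<^sub>R y) = (*\<^sub>R) s ` orbit_tangent br y"
  unfolding orbit_tangent_def by (simp add: image_image br_simps)

text \<open>This puts the scaled chart into the family whose supremum is the measure, over the same
  parameter domain \<open>U\<close>.\<close>

lemma (in lie_alg) orbit_param_scale:
  assumes par: "orbit_param br x bs U \<phi> D" and s: "s \<noteq> 0"
    and orb: "\<And>y. y \<in> adjoint_orbit br x \<Longrightarrow> s *\<^sub>R y \<in> adjoint_orbit br x"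
  shows "orbit_param br x bs U (\<lambda>u. s *\<^sub>R \<phi> u) (\<lambda>u v. s *\<^sub>R D u v)"
proof -
  have "(\<lambda>v. s *\<^sub>R D u v) ` span (set bs) = orbit_tangent br (s *\<^sub>R \<phi> u)" if "u \<in> U" for u
  proof -
    have "D u ` span (set bs) = orbit_tangent br (\<phi> u)" using par that by (simp add: orbit_param_def)
    then show ?thesis unfolding orbit_tangent_scale[OF s] by (metis image_image)
  qed
  moreover have "inj_on (\<lambda>u. s *\<^sub>R \<phi> u) U"
    using par s by (auto simp: orbit_param_def inj_on_def)
  moreover have "(\<lambda>u. s *\<^sub>R \<phi> u) ` U \<subseteq> adjoint_orbit br x"
    using par orb by (auto simp: orbit_param_def)
  ultimately show ?thesis
    using par unfolding orbit_param_def
    by (auto intro!: has_derivative_scaleR_right continuous_intros)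
qed

context semisimple_lie_alg
begin

lemma adjoint_orbit_scale:
  assumes "lie_nilpotent br x" "y \<in> adjoint_orbit br x"
  shows "exp s *\<^sub>R y \<in> adjoint_orbit br x"
proof -
  obtain h where h: "br h x = x" using eigenvector_of_nilpotent[OF assms(1)] by blast
  obtain g where g: "g \<in> adjoint_group br" "y = g x" using assms(2) by (auto simp: adjoint_orbit_def)
  have "exp s *\<^sub>R y = g (exp_ad br (s *\<^sub>R h) x)"
    by (simp add: g(2) exp_ad_eigenvector[OF h] linear_cmul[OF adjoint_group_linear[OF g(1)]])
  moreover have "g \<circ> exp_ad br (s *\<^sub>R h) \<in> adjoint_group br"
    by (intro adjoint_group_comp g exp_ad_in_adjoint_group)
  ultimately show ?thesis
    using imageI[of "g \<circ> exp_ad br (s *\<^sub>R h)" "adjoint_group br" "\<lambda>g. g x"] by (simp add: adjoint_orbit_def)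
qed

lemma adjoint_orbit_uminus:
  assumes "- x \<in> adjoint_orbit br x" "y \<in> adjoint_orbit br x"
  shows "- y \<in> adjoint_orbit br x"
proof -
  obtain g where g: "g \<in> adjoint_group br" "y = g x" using assms(2) by (auto simp: adjoint_orbit_def)
  have "- y = g (- x)" by (simp add: g(2) linear_neg[OF adjoint_group_linear[OF g(1)]])
  then show ?thesis using adjoint_group_orbit[OF g(1) assms(1)] by simp
qed

lemma liouville_integral_infinite:
  assumes nil: "lie_nilpotent br x" and "x \<noteq> 0" and neg: "- x \<in> adjoint_orbit br x"
  shows "(\<integral>\<^sup>+ y. ennreal (exp (- killing br \<beta> y)) \<partial>(liouville_measure br x)) = \<infinity>"
proof -
  let ?I = "\<integral>\<^sup>+ y. ennreal (exp (- killing br \<beta> y)) \<partial>(liouville_measure br x)"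
  obtain bs U \<phi> Z n where par: "orbit_param br x bs U \<phi> (\<lambda>u v. br (Z u v) (\<phi> u))" and "0 \<in> U"
    and n: "dim (orbit_tangent br x) = 2 * n"
    and cont: "\<And>b. continuous_on U (\<lambda>u. Z u b)" "continuous_on U \<phi>"
    and pos: "\<And>u. u \<in> U \<Longrightarrow> two_form_power (\<lambda>a b. killing br (\<phi> u) (br (Z u a) (Z u b))) n ((!) bs) > 0"
    by (rule orbit_param_exists) blast
  define F where "F u = two_form_power (\<lambda>a b. killing br (\<phi> u) (br (Z u a) (Z u b))) n ((!) bs)" for u
  let ?M = "restrict_space (lborel_span bs) U"
  have U: "openin (top_of_set (span (set bs))) U" using par by (simp add: orbit_param_def)
  then have U_sub: "U \<subseteq> span (set bs)" by (rule openin_imp_subset)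
  have space_M: "space ?M = U"
    using U_sub by (auto simp: space_restrict_space lborel_span_def)
  have F_cont: "continuous_on U F"
    unfolding F_def two_form_power_def
    by (intro continuous_intros bounded_bilinear.continuous_on[OF bounded_bilinear_killing]
        bounded_bilinear.continuous_on[OF bounded_bilinear_br] cont) simp
  have G_cont: "continuous_on U (\<lambda>u. killing br \<beta> (\<phi> u))"
    by (intro bounded_bilinear.continuous_on[OF bounded_bilinear_killing] continuous_intros cont)
  note [measurable] = borel_measurable_lborel_span[OF F_cont U_sub] borel_measurable_lborel_span[OF G_cont U_sub]

  have bound: "ennreal (\<bar>s\<bar> ^ n) * (\<integral>\<^sup>+ u. ennreal (F u) * indicator {u. s * killing br \<beta> (\<phi> u) \<le> 0} u \<partial>?M) \<le> ?I"
    if s: "s \<noteq> 0" "\<And>y. y \<in> adjoint_orbit br x \<Longrightarrow> s *\<^sub>R y \<in> adjoint_orbit br x" for s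
  proof -
    \<comment> \<open>The field \<open>Z u\<close> serves at \<open>s *\<^sub>R \<phi> u\<close>
      too, so each of the \<open>n\<close> factors gains one \<open>s\<close>.\<close>
    have dens: "liouville_form br (s *\<^sub>R \<phi> u) (\<lambda>i. s *\<^sub>R br (Z u (bs ! i)) (\<phi> u)) = s ^ n * F u" if "u \<in> U" for u
    proof -
      have "s *\<^sub>R \<phi> u \<in> adjoint_orbit br x" using par that s(2) by (auto simp: orbit_param_def)
      then have "dim (orbit_tangent br (s *\<^sub>R \<phi> u)) = 2 * n" using dim_orbit_tangent n by metis
      from liouville_form_fields[OF this, of "Z u" bs] show ?thesis
        by (simp add: br_simps killing_simps F_def two_form_power_def prod.distrib sum_distrib_left mult_ac)
    qed
    have "ennreal (\<bar>s\<bar> ^ n) * (\<integral>\<^sup>+ u. ennreal (F u) * indicator {u. s * killing br \<beta> (\<phi> u) \<le> 0} u \<partial>?M)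
        = (\<integral>\<^sup>+ u. ennreal (\<bar>s\<bar> ^ n) * (ennreal (F u) * indicator {u. s * killing br \<beta> (\<phi> u) \<le> 0} u) \<partial>?M)"
      by (intro nn_integral_cmult[symmetric]) measurable
    also have "\<dots> \<le> (\<integral>\<^sup>+ u. ennreal \<bar>s ^ n * F u\<bar> * ennreal (exp (- killing br \<beta> (s *\<^sub>R \<phi> u))) \<partial>?M)"
    proof (rule nn_integral_mono)
      fix u assume "u \<in> space ?M"
      then have "F u > 0" using pos by (simp add: space_M F_def)
      then have "ennreal \<bar>s ^ n * F u\<bar> = ennreal (\<bar>s\<bar> ^ n) * ennreal (F u)"
        by (simp add: abs_mult power_abs ennreal_mult)
      moreover have "indicator {u. s * killing br \<beta> (\<phi> u) \<le> 0} u \<le> ennreal (exp (- killing br \<beta> (s *\<^sub>R \<phi> u)))"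
        by (auto simp: indicator_def killing_simps one_le_exp_iff simp flip: ennreal_1 intro!: ennreal_leI)
      ultimately show "ennreal (\<bar>s\<bar> ^ n) * (ennreal (F u) * indicator {u. s * killing br \<beta> (\<phi> u) \<le> 0} u)
          \<le> ennreal \<bar>s ^ n * F u\<bar> * ennreal (exp (- killing br \<beta> (s *\<^sub>R \<phi> u)))"
        by (simp add: mult.assoc mult_left_mono)
    qed
    also have "\<dots> \<le> ?I"
    proof (rule liouville_measure_ge[OF orbit_param_scale[OF par s]])
      show "(\<lambda>y. ennreal (exp (- killing br \<beta> y))) \<in> borel_measurable borel"
        by (intro borel_measurable_continuous_onI continuous_on_ennreal continuous_intros
            bounded_bilinear.continuous_on[OF bounded_bilinear_killing])
    qed (use dens in \<open>auto intro!: continuous_intros cont F_cont\<close>)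
    finally show ?thesis .
  qed

  \<comment> \<open>\<open>I\<close> depends only on the sign of its argument; \<open>I 1\<close>
    and \<open>I (- 1)\<close> together cover \<open>U\<close>, so one of them is nonzero.\<close>
  define I where "I e = (\<integral>\<^sup>+ u. ennreal (F u) * indicator {u. e * killing br \<beta> (\<phi> u) \<le> 0} u \<partial>?M)" for e :: real
  obtain T where "open T" "U = span (set bs) \<inter> T" using U by (auto simp: openin_open)
  then have "U \<in> sets (lborel_span bs)"
    by (simp add: lborel_span_def sets_restrict_space)
  then have "emeasure ?M U = emeasure (lborel_span bs) U"
    by (intro emeasure_restrict_space) (simp_all add: sets.Int_space_eq2)
  then have "emeasure ?M U > 0"
    using emeasure_lborel_span_pos[OF U \<open>0 \<in> U\<close>] by (simp only:)
  moreover have "ennreal (F u) \<noteq> 0" if "u \<in> U" for u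
    using pos[OF that] unfolding F_def[symmetric] ennreal_eq_0_iff by linarith
  then have "{u \<in> space ?M. ennreal (F u) \<noteq> 0} = U"
    unfolding space_M by blast
  ultimately have "(\<integral>\<^sup>+ u. ennreal (F u) \<partial>?M) \<noteq> 0"
    by (subst nn_integral_0_iff) auto
  moreover have "(\<integral>\<^sup>+ u. ennreal (F u) \<partial>?M) \<le> I 1 + I (- 1)"
    unfolding I_def by (subst nn_integral_add[symmetric]) (auto intro!: nn_integral_mono simp: indicator_def)
  ultimately obtain e where e: "e = 1 \<or> e = - 1" "I e \<noteq> 0"
    by (metis add_0 le_zero_eq)

  \<comment> \<open>x = [h, x] is tangent at x, so the orbit has positive dimension and the factor
    s^n really grows.\<close>
  obtain h where "br h x = x" using eigenvector_of_nilpotent[OF nil] by blast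
  then have "x \<in> orbit_tangent br x" unfolding orbit_tangent_def by (metis rangeI)
  then have "dim (orbit_tangent br x) \<noteq> 0" using \<open>x \<noteq> 0\<close> unfolding dim_eq_0 by blast
  then have "n \<noteq> 0" using n by simp
  have "of_nat k * I e \<le> ?I" for k
  proof -
    define s where "s = e * exp (real k)"
    have "s *\<^sub>R y \<in> adjoint_orbit br x" if "y \<in> adjoint_orbit br x" for y
      using e(1) adjoint_orbit_scale[OF nil that] adjoint_orbit_uminus[OF neg]
      by (auto simp: s_def)
    then have "ennreal (\<bar>s\<bar> ^ n) * I s \<le> ?I"
      unfolding I_def using e(1) by (intro bound) (auto simp: s_def)
    moreover have "I s = I e"
      unfolding I_def s_def by (simp add: mult_le_0_iff zero_le_mult_iff mult.assoc mult.left_commute[of e])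
    moreover have "real k \<le> \<bar>s\<bar> ^ n"
    proof -
      have "real k \<le> exp (real k)" using exp_ge_add_one_self[of "real k"] by linarith
      also have "\<dots> \<le> exp (real k) ^ n" using \<open>n \<noteq> 0\<close> by (intro self_le_power) auto
      finally show ?thesis using e(1) by (auto simp: s_def)
    qed
    then have "of_nat k \<le> ennreal (\<bar>s\<bar> ^ n)" by (simp add: ennreal_leI flip: ennreal_of_nat_eq_real_of_nat)
    ultimately show ?thesis by (metis mult_right_mono order_trans zero_le)
  qed
  \<comment> \<open>Since \<open>I e\<close> is nonzero, an infinite multiple of it is
    infinite.\<close>
  then have "(SUP k. of_nat k) * I e \<le> ?I"
    unfolding SUP_mult_right_ennreal by (intro SUP_least)
  then show ?thesis
    using e(2) by (simp add: ennreal_SUP_of_nat_eq_top ennreal_top_mult top_unique)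
qed

end

theorem proposition2p7:
  fixes br :: "'a::euclidean_space \<Rightarrow> 'a \<Rightarrow> 'a" and x :: 'a
  assumes "semisimple_lie_algebra br"
    and "lie_nilpotent br x" and "x \<noteq> 0"
    and "- x \<in> adjoint_orbit br x"
  shows "\<forall>\<beta>. (\<integral>\<^sup>+ y. ennreal (exp (- killing br \<beta> y)) \<partial>(liouville_measure br x)) = \<infinity>"
  using semisimple_lie_alg.liouville_integral_infinite[OF semisimple_lie_alg.intro[OF assms(1)]] assms(2-4)
  by blast

end
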